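(* Let $\mu=\delta_d/2$. There exists a non-empty Zariski open subset $U\subset\mathbb C^2$ such that for every $\bar\tau=(\tau_1,\tau_2)\in U$: (1) if $\hat p$ is an affine regular point of $\mathcal C$ which is either the origin or isotropic, then $N(\hat p,\bar\tau)\neq0$ (with $\hat p$ written as $(a:b:1)$); (2) the set $\hat\Gamma(\bar\tau)$ of affine non-isotropic points $\hat p$ of $\mathcal C$ satisfying $N(\hat p,\bar\tau)=0$ consists of exactly $\mu$ pairwise distinct points $\hat p_1,\dots,\hat p_\mu$; (3) writing $\hat p_i=(a_i,b_i)$ and choosing $d_i$ with $d_i^2=(a_i-\tau_1)^2+(b_i-\tau_2)^2$, the numbers $d_1^2,\dots,d_\mu^2$ are pairwise distinct and nonzero; (4) for each $i$, $\bar\tau\in\mathcal O_{d_i}(\mathcal C)=\mathcal O_{-d_i}(\mathcal C)$, and $\bar\tau$ is the point of this offset generated by $\hat p_i$, i.e. there is $u_0\in\mathbb C$ such that $(\hat p_i,\bar\tau,d_i,u_0)\in\Omega(d)$ or $(\hat p_i,\bar\tau,-d_i,u_0)\in\Omega(d)$.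
   Context: Standing assumptions and notation. $f(y_1,y_2)\in\mathbb C[y_1,y_2]$ is an irreducible polynomial of degree $n$ defining an affine plane curve $\mathcal C\subset\mathbb C^2$; $\mathcal C$ is not a line, and $f$ does not divide $f_1^2+f_2^2$, where $f_i=\partial f/\partial y_i$. Write $\bar y=(y_1,y_2)$, $\bar x=(x_1,x_2)$, and let $d,u$ be further variables. Put $b(\bar y,\bar x,d)=(x_1-y_1)^2+(x_2-y_2)^2-d^2$, $n(\bar y,\bar x)=-f_2(\bar y)(x_1-y_1)+f_1(\bar y)(x_2-y_2)$, $w(\bar y,u)=u(f_1^2(\bar y)+f_2^2(\bar y))-1$. Let $\Omega(d)\subset\mathbb C^6$ be the common zero set of $f,b,n,w$ in the variables $(\bar y,\bar x,d,u)$, and for $d_0\in\mathbb C\setminus\{0\}$ let $I(d_0)=\langle f,b(\bar y,\bar x,d_0),n,w\rangle\subset\mathbb C[\bar y,\bar x,u]$ and $\Omega(d_0)\subset\mathbb C^5$ its zero set. The offset of $\mathcal C$ at distance $d_0$ is $\mathcal O_{d_0}(\mathcal C)$, the Zariski closure of the projection of $\Omega(d_0)$ to the $\bar x$-coordinates; the generic offset $\mathcal O_d(\mathcal C)\subset\mathbb C^3$ is the Zariski closure of the projection of $\Omega(d)$ to the $(\bar x,d)$-coordinates (it is a surface). The generic offset equation $g(x_1,x_2,d)\in\mathbb C[\bar x,d]$ is a square-free polynomial defining the surface $\mathcal O_d(\mathcal C)$, normalized to have no factor of positive degree lying in $\mathbb C[d]$ (it is determined up to a nonzero constant factor). $\delta_d=\deg_d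 g$, which is even. Projective notation: $F(y_1,y_2,y_3)=y_3^nf(y_1/y_3,y_2/y_3)$, $F_i=\partial F/\partial y_i$, $\bar y_H=(y_1:y_2:y_3)$, and $N(\bar y_H,\bar x)=-F_2(\bar y_H)(x_1y_3-y_1)+F_1(\bar y_H)(x_2y_3-y_2)$. An affine point $p$ of $\mathcal C$ is isotropic if $f_1^2(p)+f_2^2(p)=0$, and regular if it is nonsingular. *)

theory Defs
  imports "HOL-Computational_Algebra.Computational_Algebra"
begin

text \<open>Bivariate polynomials in (y1,y2) are nested univariate polynomials:
  a value p :: complex poly poly is a polynomial in the outer variable y2 whose
  coefficients are polynomials in the inner variable y1.
  Trivariate polynomials in (x1,x2,d) are complex poly poly poly with
  x1 innermost, x2 middle, d outermost.\<close>

type_synonym poly2 = "complex poly poly"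
type_synonym poly3 = "complex poly poly poly"

definition ev2 :: "poly2 \<Rightarrow> complex \<Rightarrow> complex \<Rightarrow> complex" where
  "ev2 p a b = poly (map_poly (\<lambda>c. poly c a) p) b"

definition ev3 :: "poly3 \<Rightarrow> complex \<Rightarrow> complex \<Rightarrow> complex \<Rightarrow> complex" where
  "ev3 p a b c = poly (map_poly (\<lambda>q. ev2 q a b) p) c"

definition pd1 :: "poly2 \<Rightarrow> poly2" where
  "pd1 p = map_poly pderiv p"

definition pd2 :: "poly2 \<Rightarrow> poly2" where
  "pd2 p = pderiv p"

definition zclosed2 :: "(complex \<times> complex) set \<Rightarrow> bool" where
  "zclosed2 Z \<longleftrightarrow> (\<exists>H::poly2 set. Z = {(a,b). \<forall>h\<in>H. ev2 h a b = 0})"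

definition zopen2 :: "(complex \<times> complex) set \<Rightarrow> bool" where
  "zopen2 U \<longleftrightarrow> zclosed2 (- U)"

definition zclosure2 :: "(complex \<times> complex) set \<Rightarrow> (complex \<times> complex) set" where
  "zclosure2 S = \<Inter>{Z. zclosed2 Z \<and> S \<subseteq> Z}"

definition zclosed3 :: "(complex \<times> complex \<times> complex) set \<Rightarrow> bool" where
  "zclosed3 Z \<longleftrightarrow> (\<exists>H::poly3 set. Z = {(a,b,c). \<forall>h\<in>H. ev3 h a b c = 0})"

definition zclosure3 :: "(complex \<times> complex \<times> complex) set \<Rightarrow> (complex \<times> complex \<times> complex) set" where
  "zclosure3 S = \<Inter>{Z. zclosed3 Z \<and> S \<subseteq> Z}"

definition curve :: "poly2 \<Rightarrow> (complex \<times> complex) set" where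
  "curve f = {(a,b). ev2 f a b = 0}"

definition is_line :: "(complex \<times> complex) set \<Rightarrow> bool" where
  "is_line S \<longleftrightarrow> (\<exists>\<alpha> \<beta> \<gamma>. (\<alpha>,\<beta>) \<noteq> (0,0) \<and> S = {(a,b). \<alpha>*a + \<beta>*b + \<gamma> = 0})"

definition bfun :: "complex \<Rightarrow> complex \<Rightarrow> complex \<Rightarrow> complex \<Rightarrow> complex \<Rightarrow> complex" where
  "bfun y1 y2 x1 x2 d = (x1 - y1)^2 + (x2 - y2)^2 - d^2"

definition nfun :: "poly2 \<Rightarrow> complex \<Rightarrow> complex \<Rightarrow> complex \<Rightarrow> complex \<Rightarrow> complex" where
  "nfun f y1 y2 x1 x2 = - ev2 (pd2 f) y1 y2 * (x1 - y1) + ev2 (pd1 f) y1 y2 * (x2 - y2)"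

definition wfun :: "poly2 \<Rightarrow> complex \<Rightarrow> complex \<Rightarrow> complex \<Rightarrow> complex" where
  "wfun f y1 y2 u = u * ((ev2 (pd1 f) y1 y2)^2 + (ev2 (pd2 f) y1 y2)^2) - 1"

definition Omega :: "poly2 \<Rightarrow> ((complex \<times> complex) \<times> (complex \<times> complex) \<times> complex \<times> complex) set" where
  "Omega f = {((y1,y2),(x1,x2),d,u). ev2 f y1 y2 = 0 \<and> bfun y1 y2 x1 x2 d = 0
                 \<and> nfun f y1 y2 x1 x2 = 0 \<and> wfun f y1 y2 u = 0}"

definition Omega_at :: "poly2 \<Rightarrow> complex \<Rightarrow> ((complex \<times> complex) \<times> (complex \<times> complex) \<times> complex) set" where
  "Omega_at f d0 = {((y1,y2),(x1,x2),u). ev2 f y1 y2 = 0 \<and> bfun y1 y2 x1 x2 d0 = 0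
                 \<and> nfun f y1 y2 x1 x2 = 0 \<and> wfun f y1 y2 u = 0}"

definition offset :: "poly2 \<Rightarrow> complex \<Rightarrow> (complex \<times> complex) set" where
  "offset f d0 = zclosure2 ((\<lambda>(y,x,u). x) ` Omega_at f d0)"

definition generic_offset :: "poly2 \<Rightarrow> (complex \<times> complex \<times> complex) set" where
  "generic_offset f = zclosure3 ((\<lambda>(y,(x1,x2),d,u). (x1,x2,d)) ` Omega f)"

definition generic_offset_eq :: "poly2 \<Rightarrow> poly3 \<Rightarrow> bool" where
  "generic_offset_eq f g \<longleftrightarrow>
     squarefree g \<and>
     {(x1,x2,d). ev3 g x1 x2 d = 0} = generic_offset f \<and>
     \<not> (\<exists>q. q dvd g \<and> degree q > 0 \<and> (\<forall>i. \<exists>c. coeff q i = [:[:c:]:]))"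

end

(* A point tau generates, through each foot p of a normal of the curve passing through tau, the roots
   d = +-sqrt(D(p)) of g(tau, d), where D(p) = |tau - p|^2; so the count mu = deg_d(g) / 2 amounts to
   three facts for generic tau: g(tau, d) has only simple roots, all its roots come from feet, and
   distinct feet have distinct D.
   The first holds because g is square-free. For the second, the set of points (tau, d) coming from
   feet is constructible, hence over a generic tau contains all or none of the zeros of any prime
   factor of g; "none" would allow to drop that factor from g. For the third, the vector from the foot p
   to tau is, up to scaling, the tau-gradient of d, so p can be recovered from tau, d and the
   derivatives of g. *)

theory Submission
  imports Defs "HOL-Computational_Algebra.Field_as_Ring"
begin

section \<open>Evaluation of polynomials\<close>

text \<open>Genericity conditions mostly come from one device: if two polynomials share no prime
  factor of positive degree in the main variable, some combination of them is a nonzero r free of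
  that variable, and off r = 0 they have no common zero. Constructibility is forced by the
  definition of g: its zero set is a Zariski closure, and closing up may add points that belong to
  no foot. Hence a projection theorem is proved, strong enough to eliminate the two coordinates of
  the foot. Evenness of g in d is never assumed. Instead g is written as g0(x, d^2) + d g1(x, d^2).
  Since d and -d belong to the same foot, both parts vanish along the normals; they are polynomials
  in the squared distance, so their gradients involve no choice of a square root. The parity of
  deg_d g is a by-product: for generic tau, 0 is not a root of g(tau, d), and the roots are all
  square roots of the values D(p). Finiteness of the set of feet is obtained in the same way, from
  the finitely many roots of g(tau, d) and the injectivity of D.\<close>

lemma poly_map_poly_add:
  fixes \<phi> :: "'a::comm_ring_1 \<Rightarrow> complex"
  assumes "\<phi> 0 = 0" "\<And>x y. \<phi> (x + y) = \<phi> x + \<phi> y"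
  shows "poly (map_poly \<phi> (p + q)) z = poly (map_poly \<phi> p) z + poly (map_poly \<phi> q) z"
  by (induction p q rule: poly_induct2) (simp_all add: assms map_poly_pCons algebra_simps)

lemma poly_map_poly_smult:
  fixes \<phi> :: "'a::comm_ring_1 \<Rightarrow> complex"
  assumes "\<phi> 0 = 0" "\<And>x y. \<phi> (x * y) = \<phi> x * \<phi> y"
  shows "poly (map_poly \<phi> (smult c p)) z = \<phi> c * poly (map_poly \<phi> p) z"
  by (induction p) (simp_all add: assms map_poly_pCons algebra_simps)

lemma poly_map_poly_mult:
  fixes \<phi> :: "'a::comm_ring_1 \<Rightarrow> complex"
  assumes "\<phi> 0 = 0" "\<And>x y. \<phi> (x + y) = \<phi> x + \<phi> y" "\<And>x y. \<phi> (x * y) = \<phi> x * \<phi> y"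
  shows "poly (map_poly \<phi> (p * q)) z = poly (map_poly \<phi> p) z * poly (map_poly \<phi> q) z"
  by (induction p)
    (simp_all add: assms map_poly_pCons poly_map_poly_add poly_map_poly_smult algebra_simps)

lemma ev2_0 [simp]: "ev2 0 a b = 0"
  by (simp add: ev2_def)

lemma ev2_pCons [simp]: "ev2 (pCons c p) a b = poly c a + b * ev2 p a b"
  by (simp add: ev2_def map_poly_pCons)

lemma ev2_add [simp]: "ev2 (p + q) a b = ev2 p a b + ev2 q a b"
  by (simp add: ev2_def poly_map_poly_add)

lemma ev2_mult [simp]: "ev2 (p * q) a b = ev2 p a b * ev2 q a b"
  by (simp add: ev2_def poly_map_poly_mult)

lemma ev2_1 [simp]: "ev2 1 a b = 1"
  by (simp add: one_pCons)

lemma ev2_power [simp]: "ev2 (p ^ n) a b = ev2 p a b ^ n"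
  by (induction n) simp_all

lemma ev3_0 [simp]: "ev3 0 a b d = 0"
  by (simp add: ev3_def)

lemma ev3_pCons [simp]: "ev3 (pCons c p) a b d = ev2 c a b + d * ev3 p a b d"
  by (simp add: ev3_def map_poly_pCons)

lemma ev3_add [simp]: "ev3 (p + q) a b d = ev3 p a b d + ev3 q a b d"
  by (simp add: ev3_def poly_map_poly_add)

lemma ev3_mult [simp]: "ev3 (p * q) a b d = ev3 p a b d * ev3 q a b d"
  by (simp add: ev3_def poly_map_poly_mult)

lemma ev3_1 [simp]: "ev3 1 a b d = 1"
  by (simp add: one_pCons)

lemma ev2_nonzero_exists:
  assumes "r \<noteq> 0"
  shows "\<exists>a b. ev2 r a b \<noteq> 0"
proof -
  obtain a where a: "poly (lead_coeff r) a \<noteq> 0"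
    using assms by (metis leading_coeff_0_iff poly_all_0_iff_0)
  have "map_poly (\<lambda>c. poly c a) r \<noteq> 0"
    using a by (metis coeff_0 coeff_map_poly poly_0)
  then show ?thesis
    unfolding ev2_def by (metis poly_all_0_iff_0)
qed

lemma map_poly_root_exists:
  fixes \<phi> :: "'a::comm_ring_1 \<Rightarrow> complex"
  assumes "\<phi> (lead_coeff p) \<noteq> 0" "degree p > 0"
  shows "\<exists>z. poly (map_poly \<phi> p) z = 0"
proof -
  have "degree (map_poly \<phi> p) = degree p"
    using assms(1) by (rule map_poly_degree_eq)
  with assms(2) have "\<not> constant (poly (map_poly \<phi> p))"
    by (simp add: constant_degree)
  then show ?thesis
    by (rule fundamental_theorem_of_algebra)
qed

section \<open>Elimination with constants and plane curves\<close>

lemma degree_eq_0_if_prime_factors_const: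
  fixes m :: "'a::{factorial_ring_gcd,semiring_gcd_mult_normalize} poly"
  assumes "m \<noteq> 0" "\<And>\<pi>. prime \<pi> \<Longrightarrow> \<pi> dvd m \<Longrightarrow> degree \<pi> = 0"
  shows "degree m = 0"
  using assms
proof (induction m rule: prime_divisors_induct)
  case (unit x)
  then show ?case by (auto simp: is_unit_poly_iff)
next
  case (factor p x)
  then have "x \<noteq> 0" by auto
  then have "degree x = 0" using factor by (meson dvd_mult)
  moreover have "degree p = 0" using factor by auto
  ultimately show ?case by (metis add_0 degree_mult_eq_0 degree_mult_eq)
qed simp

text \<open>A nonzero element of minimal degree in the ideal \<open>(p, q)\<close> divides constant multiples of
  both generators by pseudo-division, so its non-constant prime factors divide both.\<close>

lemma bezout_const_or_common_prime:
  fixes p q :: "'a::{factorial_ring_gcd,semiring_gcd_mult_normalize} poly"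
  assumes "p \<noteq> 0"
  shows "(\<exists>A B r. r \<noteq> 0 \<and> A * p + B * q = [:r:]) \<or>
         (\<exists>\<pi>. prime \<pi> \<and> degree \<pi> > 0 \<and> \<pi> dvd p \<and> \<pi> dvd q)"
proof -
  define J where "J = {h. \<exists>A B. h = A * p + B * q}"
  have pJ: "p \<in> J" unfolding J_def by (rule CollectI, rule exI[of _ 1], rule exI[of _ 0]) simp
  have qJ: "q \<in> J" unfolding J_def by (rule CollectI, rule exI[of _ 0], rule exI[of _ 1]) simp
  have smultJ: "smult c h - m * k \<in> J" if "h \<in> J" "m \<in> J" for c h m k
  proof -
    from that obtain A B A' B' where "h = A * p + B * q" "m = A' * p + B' * q"
      unfolding J_def by auto
    then have "smult c h - m * k = (smult c A - k * A') * p + (smult c B - k * B') * q"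
      by (simp add: algebra_simps smult_add_right)
    then show ?thesis unfolding J_def by blast
  qed
  define m where "m = arg_min degree (\<lambda>h. h \<in> J \<and> h \<noteq> 0)"
  have m: "m \<in> J" "m \<noteq> 0" and min: "\<And>h. h \<in> J \<Longrightarrow> h \<noteq> 0 \<Longrightarrow> degree m \<le> degree h"
    using arg_min_nat_lemma[of "\<lambda>h. h \<in> J \<and> h \<noteq> 0" p degree] pJ assms
    unfolding m_def by auto
  have dvd: "\<exists>c. c \<noteq> 0 \<and> m dvd smult c h" if h: "h \<in> J" for h
  proof -
    from pseudo_mod(1)[OF m(2), of h] obtain c k
      where ck: "c \<noteq> 0" "smult c h = m * k + pseudo_mod h m" by blast
    have "pseudo_mod h m \<in> J"
      using smultJ[OF h m(1), of c k] ck(2) by simp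
    then have "pseudo_mod h m = 0"
      using pseudo_mod(2)[OF m(2), of h] min by fastforce
    with ck show ?thesis by auto
  qed
  show ?thesis
  proof (cases "degree m = 0")
    case True
    then obtain r where "m = [:r:]" by (rule degree_eq_zeroE)
    then show ?thesis using m unfolding J_def by auto metis
  next
    case False
    then obtain \<pi> where \<pi>: "prime \<pi>" "\<pi> dvd m" "degree \<pi> > 0"
      using degree_eq_0_if_prime_factors_const[OF m(2)] by auto
    have "\<pi> dvd h" if h: "h \<in> J" for h
    proof -
      from dvd[OF h] obtain c where c: "c \<noteq> 0" "m dvd smult c h" by blast
      then have "\<pi> dvd [:c:] * h" using \<pi>(2) by (simp add: dvd_trans)
      moreover have "\<not> \<pi> dvd [:c:]"
        using \<pi>(3) c(1) dvd_imp_degree_le[of \<pi> "[:c:]"] by auto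
      ultimately show ?thesis using prime_dvd_mult_iff[OF \<pi>(1), of "[:c:]" h] by blast
    qed
    then show ?thesis using \<pi> pJ qJ by blast
  qed
qed

text \<open>A prime factor of an irreducible p is associated to p, so a common prime factor would
  make p divide q. The constant r lies in the coefficient ring: wherever it specializes to a nonzero
  value, p and q have no common root.\<close>

lemma bezout_const_irreducible:
  fixes p q :: "'a::{factorial_ring_gcd,semiring_gcd_mult_normalize} poly"
  assumes "irreducible p" "\<not> p dvd q"
  shows "\<exists>A B r. r \<noteq> 0 \<and> A * p + B * q = [:r:]"
proof -
  have "p \<noteq> 0" using assms by auto
  moreover have "p dvd \<pi>" if "prime \<pi>" "\<pi> dvd p" for \<pi>
    using that assms(1) by (metis irreducibleD' not_prime_unit)
  ultimately show ?thesis
    using bezout_const_or_common_prime[of p q] assms(2) dvd_trans by blast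
qed

text \<open>r plays the role of a discriminant. If a prime of positive degree divided both p =
  \<open>\<pi> * h\<close> and its derivative, it would divide h, because it cannot divide its own
  derivative in characteristic 0; then its square would divide p.\<close>

lemma bezout_const_squarefree_pderiv:
  fixes p :: "'a::{factorial_ring_gcd,semiring_gcd_mult_normalize,ring_char_0} poly"
  assumes "squarefree p"
  shows "\<exists>A B r. r \<noteq> 0 \<and> A * p + B * pderiv p = [:r:]"
proof -
  have "p \<noteq> 0" using assms by auto
  moreover have False if \<pi>: "prime \<pi>" "degree \<pi> > 0" "\<pi> dvd p" "\<pi> dvd pderiv p" for \<pi>
  proof -
    from \<pi>(3) obtain h where h: "p = \<pi> * h" by blast
    then have "\<pi> dvd pderiv \<pi> * h"
      using \<pi>(4) by (simp add: pderiv_mult dvd_add_right_iff mult.commute)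
    moreover have "\<not> \<pi> dvd pderiv \<pi>"
    proof
      assume "\<pi> dvd pderiv \<pi>"
      then have "degree \<pi> \<le> degree \<pi> - 1"
        using dvd_imp_degree_le[of \<pi> "pderiv \<pi>"] \<pi>(2) by (auto simp: degree_pderiv pderiv_eq_0_iff)
      with \<pi>(2) show False by simp
    qed
    ultimately have "\<pi> dvd h" using \<pi>(1) by (simp add: prime_dvd_mult_iff)
    then have "\<pi>\<^sup>2 dvd p" using h by (simp add: power2_eq_square)
    then show False using assms \<pi>(1) squarefreeD not_prime_unit by blast
  qed
  ultimately show ?thesis
    using bezout_const_or_common_prime[of p "pderiv p"] by blast
qed

text \<open>Study's lemma, the Nullstellensatz for a hypersurface. Otherwise f and q combine to a
  nonzero r in y1 alone. Over a value of y1 where neither r nor the leading coefficient of f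
  vanishes, f has a root, and there q cannot vanish.\<close>

lemma irreducible_dvd_if_vanish:
  fixes f q :: poly2
  assumes irr: "irreducible f" and deg: "degree f > 0"
    and van: "\<And>a b. ev2 f a b = 0 \<Longrightarrow> ev2 q a b = 0"
  shows "f dvd q"
proof (rule ccontr)
  assume "\<not> f dvd q"
  from bezout_const_irreducible[OF irr this] obtain A B r
    where r: "r \<noteq> 0" "A * f + B * q = [:r:]" by blast
  have "r * lead_coeff f \<noteq> 0" using r deg by auto
  then obtain a where "poly (r * lead_coeff f) a \<noteq> 0"
    by (metis poly_all_0_iff_0)
  then have a: "poly r a \<noteq> 0" "poly (lead_coeff f) a \<noteq> 0" by auto
  obtain b where b: "ev2 f a b = 0"
    using map_poly_root_exists[of "\<lambda>c. poly c a", OF a(2) deg] unfolding ev2_def by blast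
  have "ev2 (A * f + B * q) a b = poly r a" by (simp add: r(2))
  with b van[OF b] a(1) show False by simp
qed

lemma irreducible_dvd_if_vanish3:
  fixes f q :: poly3
  assumes irr: "irreducible f" and deg: "degree f > 0"
    and van: "\<And>a b d. ev3 f a b d = 0 \<Longrightarrow> ev3 q a b d = 0"
  shows "f dvd q"
proof (rule ccontr)
  assume "\<not> f dvd q"
  from bezout_const_irreducible[OF irr this] obtain A B r
    where r: "r \<noteq> 0" "A * f + B * q = [:r:]" by blast
  have "r * lead_coeff f \<noteq> 0" using r deg by auto
  then obtain a b where "ev2 (r * lead_coeff f) a b \<noteq> 0"
    using ev2_nonzero_exists by blast
  then have a: "ev2 r a b \<noteq> 0" "ev2 (lead_coeff f) a b \<noteq> 0" by auto
  obtain d where d: "ev3 f a b d = 0"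
    using map_poly_root_exists[of "\<lambda>c. ev2 c a b", OF a(2) deg] unfolding ev3_def by blast
  have "ev3 (A * f + B * q) a b d = ev2 r a b" by (simp add: r(2))
  with d van[OF d] a(1) show False by simp
qed

text \<open>Elimination treats y2 as the main variable, which fails if f involves y1 alone. An
  irreducible such f is linear over the complex numbers, and its curve is a line.\<close>

lemma degree_pos_if_not_line:
  assumes irr: "irreducible f" and notline: "\<not> is_line (curve f)"
  shows "degree f > 0"
proof (rule ccontr)
  assume "\<not> degree f > 0"
  then obtain c where c: "f = [:c:]" by (metis degree_eq_zeroE neq0_conv)
  have "degree c \<noteq> 0"
  proof
    assume "degree c = 0"
    then obtain k where "c = [:k:]" by (rule degree_eq_zeroE)
    with c irr show False
      by (cases "k = 0") (auto simp: irreducible_def is_unit_poly_iff dvd_field_iff)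
  qed
  then obtain a where a: "poly c a = 0"
    using fundamental_theorem_of_algebra[of c] by (auto simp: constant_degree)
  then obtain e where e: "c = [:-a, 1:] * e" by (auto simp: poly_eq_0_iff_dvd)
  then have "f = [:[:-a, 1:]:] * [:e:]" using c by simp
  then have "[:[:-a, 1:]:] dvd (1::poly2) \<or> [:e:] dvd (1::poly2)"
    using irr by (metis irreducibleD)
  moreover have "\<not> [:[:-a, 1:]:] dvd (1::poly2)"
    by (auto simp: is_unit_poly_iff is_unit_const_poly_iff)
  ultimately have "is_unit e" by (simp add: is_unit_const_poly_iff)
  then obtain k where "e = [:k:]" "is_unit k" by (auto simp: is_unit_poly_iff)
  then have k: "e = [:k:]" "k \<noteq> 0" by auto
  have "curve f = {(x, y). 1 * x + 0 * y + (- a) = 0}"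
    unfolding curve_def c e k(1) using k(2) by (auto simp: algebra_simps)
  then have "is_line (curve f)" unfolding is_line_def
    by (intro exI[of _ 1] exI[of _ 0] exI[of _ "-a"]) auto
  with notline show False by contradiction
qed

text \<open>The Bezout constant leaves finitely many values of y1. Over each of them f keeps
  finitely many roots: if f vanished identically at y1 = a, then y1 - a would be a factor of f,
  against irreducibility and positive degree in y2.\<close>

lemma finite_common_zeros:
  fixes f q :: poly2
  assumes irr: "irreducible f" and deg: "degree f > 0" and ndvd: "\<not> f dvd q"
  shows "finite {(a, b). ev2 f a b = 0 \<and> ev2 q a b = 0}"
proof -
  from bezout_const_irreducible[OF irr ndvd] obtain A B r
    where r: "r \<noteq> 0" "A * f + B * q = [:r:]" by blast
  have "map_poly (\<lambda>c. poly c a) f \<noteq> 0" for a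
  proof
    assume "map_poly (\<lambda>c. poly c a) f = 0"
    then have "\<And>k. poly (coeff f k) a = 0"
      by (metis coeff_map_poly coeff_0 poly_0)
    then have "[:[:-a, 1:]:] dvd f"
      by (simp add: const_poly_dvd_iff poly_eq_0_iff_dvd)
    then obtain h where h: "f = [:[:-a, 1:]:] * h" by blast
    moreover have "\<not> is_unit [:[:-a, 1:]:]"
      by (auto simp: is_unit_poly_iff is_unit_const_poly_iff)
    ultimately have "is_unit h" using irr irreducibleD by blast
    then have "degree h = 0" by (auto simp: is_unit_poly_iff)
    then show False using h deg by (metis add.right_neutral degree_mult_le degree_pCons_0 le_zero_eq not_less0)
  qed
  then have "finite {b. ev2 f a b = 0}" for a
    unfolding ev2_def by (simp add: poly_roots_finite)
  then have "finite (SIGMA a:{a. poly r a = 0}. {b. ev2 f a b = 0})"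
    using poly_roots_finite[OF r(1)] by blast
  moreover have "poly r a = 0" if "ev2 f a b = 0" "ev2 q a b = 0" for a b
  proof -
    have "ev2 (A * f + B * q) a b = poly r a" by (simp add: r(2))
    with that show ?thesis by simp
  qed
  ultimately show ?thesis by (elim finite_subset[rotated]) auto
qed

section \<open>Projections of constructible sets\<close>

text \<open>Coefficient rings are represented as sets of functions on a parameter set. Adjoining a
  variable and eliminating it again then stay within the same notion, so projections can be
  iterated.\<close>

definition funring :: "('i \<Rightarrow> complex) set \<Rightarrow> bool" where
  "funring R \<longleftrightarrow> (\<forall>c. (\<lambda>i. c) \<in> R) \<and>
     (\<forall>u\<in>R. \<forall>v\<in>R. (\<lambda>i. u i + v i) \<in> R \<and> (\<lambda>i. u i * v i) \<in> R)"

text \<open>The strict bound n is uniform in the parameter and only formal: in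
  \<open>polyfam R (Suc n) P\<close> the coefficient of index n is the candidate for the leading one
  and may vanish at some parameters.\<close>

definition polyfam :: "('i \<Rightarrow> complex) set \<Rightarrow> nat \<Rightarrow> ('i \<Rightarrow> complex poly) \<Rightarrow> bool" where
  "polyfam R n P \<longleftrightarrow>
     (\<forall>k. (\<lambda>i. coeff (P i) k) \<in> R) \<and> (\<forall>k\<ge>n. \<forall>i. coeff (P i) k = 0)"

definition polyext :: "('i \<Rightarrow> complex) set \<Rightarrow> ('i \<times> complex \<Rightarrow> complex) set" where
  "polyext R = {\<lambda>(i, y). poly (P i) y | P. \<exists>n. polyfam R n P}"

text \<open>Normal form: finite unions of sets given by equations and a single inequation. Several
  inequations are merged by multiplying their left-hand sides.\<close>

inductive constructible :: "('i \<Rightarrow> complex) set \<Rightarrow> ('i \<Rightarrow> bool) \<Rightarrow> bool"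
  for R where
  basic: "finite C \<Longrightarrow> C \<subseteq> R \<Longrightarrow> q \<in> R \<Longrightarrow>
    constructible R (\<lambda>i. (\<forall>c\<in>C. c i = 0) \<and> q i \<noteq> 0)"
| disj: "constructible R S \<Longrightarrow> constructible R T \<Longrightarrow> constructible R (\<lambda>i. S i \<or> T i)"

lemma funring_const: "funring R \<Longrightarrow> (\<lambda>i. c) \<in> R"
  by (simp add: funring_def)

lemma funring_add: "funring R \<Longrightarrow> u \<in> R \<Longrightarrow> v \<in> R \<Longrightarrow> (\<lambda>i. u i + v i) \<in> R"
  by (simp add: funring_def)

lemma funring_mult: "funring R \<Longrightarrow> u \<in> R \<Longrightarrow> v \<in> R \<Longrightarrow> (\<lambda>i. u i * v i) \<in> R"
  by (simp add: funring_def)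

lemma funring_uminus: "funring R \<Longrightarrow> u \<in> R \<Longrightarrow> (\<lambda>i. - u i) \<in> R"
  using funring_mult[OF _ funring_const[of R "-1"], of u] by simp

lemma funring_diff: "funring R \<Longrightarrow> u \<in> R \<Longrightarrow> v \<in> R \<Longrightarrow> (\<lambda>i. u i - v i) \<in> R"
  using funring_add[OF _ _ funring_uminus, of R u v] by simp

lemma funring_power: "funring R \<Longrightarrow> u \<in> R \<Longrightarrow> (\<lambda>i. u i ^ n) \<in> R"
  by (induction n) (auto intro: funring_const funring_mult)

lemma funring_sum:
  "funring R \<Longrightarrow> (\<And>k. k \<in> K \<Longrightarrow> u k \<in> R) \<Longrightarrow> (\<lambda>i. \<Sum>k\<in>K. u k i) \<in> R"
  by (induction K rule: infinite_finite_induct) (auto intro: funring_const funring_add)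

lemma funring_poly:
  assumes "funring R" "u \<in> R"
  shows "(\<lambda>i. poly p (u i)) \<in> R"
  by (induction p) (use assms in \<open>auto intro: funring_const funring_add funring_mult\<close>)

lemma funring_ev2:
  assumes "funring R" "u \<in> R" "v \<in> R"
  shows "(\<lambda>i. ev2 p (u i) (v i)) \<in> R"
  by (induction p)
    (use assms in \<open>auto intro: funring_const funring_add funring_mult funring_poly\<close>)

lemma funring_ev3:
  assumes "funring R" "u \<in> R" "v \<in> R" "w \<in> R"
  shows "(\<lambda>i. ev3 p (u i) (v i) (w i)) \<in> R"
  by (induction p)
    (use assms in \<open>auto intro: funring_const funring_add funring_mult funring_ev2\<close>)

lemma constructible_nonzero:
  assumes "funring R" "c \<in> R"
  shows "constructible R (\<lambda>i. c i \<noteq> 0)"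
  using basic[of "{}" R c] assms by simp

lemma constructible_conj_basic:
  assumes R: "funring R" and C: "finite C" "C \<subseteq> R" "q \<in> R" and S: "constructible R S"
  shows "constructible R (\<lambda>i. ((\<forall>c\<in>C. c i = 0) \<and> q i \<noteq> 0) \<and> S i)"
  using S
proof induction
  case (basic D r)
  have "constructible R (\<lambda>i. (\<forall>c\<in>C \<union> D. c i = 0) \<and> q i * r i \<noteq> 0)"
    by (rule constructible.basic) (use basic C R in \<open>auto intro: funring_mult\<close>)
  then show ?case by (rule back_subst[where P = "constructible R"]) auto
next
  case (disj S T)
  from constructible.disj[OF disj.IH] show ?case
    by (rule back_subst[where P = "constructible R"]) auto
qed

lemma constructible_conj_eq:
  assumes "funring R" "c \<in> R" "constructible R S"
  shows "constructible R (\<lambda>i. c i = 0 \<and> S i)"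
  using constructible_conj_basic[of R "{c}" "\<lambda>i. 1" S] assms by (simp add: funring_const)

lemma constructible_conj_nonzero:
  assumes "funring R" "c \<in> R" "constructible R S"
  shows "constructible R (\<lambda>i. c i \<noteq> 0 \<and> S i)"
  using constructible_conj_basic[of R "{}" c S] assms by simp

text \<open>Handles the case distinction in parametric elimination: whether a formal leading
  coefficient vanishes depends on the parameter, so both branches of the algorithm
  contribute.\<close>

lemma constructible_split:
  assumes R: "funring R" and c: "c \<in> R"
    and S: "constructible R S" "\<And>i. c i = 0 \<Longrightarrow> T i = S i"
    and S': "constructible R (\<lambda>i. c i \<noteq> 0 \<and> S' i)" "\<And>i. c i \<noteq> 0 \<Longrightarrow> T i = S' i"
  shows "constructible R T"
proof -
  from disj[OF constructible_conj_eq[OF R c S(1)] S'(1)] show ?thesis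
    by (rule back_subst[where P = "constructible R"]) (use S(2) S'(2) in auto)
qed

lemma constructible_Ex_less:
  assumes "funring R" "\<And>k. k < n \<Longrightarrow> constructible R (S k)"
  shows "constructible R (\<lambda>i. \<exists>k<(n::nat). S k i)"
  using assms(2)
proof (induction n)
  case 0
  then show ?case using constructible_nonzero[OF assms(1), of "\<lambda>i. 0"] funring_const[OF assms(1)]
    by simp
next
  case (Suc n)
  then have "constructible R (\<lambda>i. (\<exists>k<n. S k i) \<or> S n i)"
    by (intro disj) auto
  then show ?case by (rule back_subst[where P = "constructible R"]) (auto simp: less_Suc_eq)
qed

section \<open>Families of polynomials and parametric pseudo-division\<close>

lemma polyfam_coeff: "polyfam R n P \<Longrightarrow> (\<lambda>i. coeff (P i) k) \<in> R"
  by (simp add: polyfam_def)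

lemma polyfam_coeff_eq_0: "polyfam R n P \<Longrightarrow> n \<le> k \<Longrightarrow> coeff (P i) k = 0"
  by (simp add: polyfam_def)

lemma polyfam_const: "funring R \<Longrightarrow> c \<in> R \<Longrightarrow> polyfam R 1 (\<lambda>i. [:c i:])"
  unfolding polyfam_def
proof (intro conjI allI impI)
  show "(\<lambda>i. coeff [:c i:] k) \<in> R" if "funring R" "c \<in> R" for k
    using that by (cases k) (auto intro: funring_const)
qed (auto simp: coeff_pCons split: nat.split)

lemma polyfam_add:
  "funring R \<Longrightarrow> polyfam R n P \<Longrightarrow> polyfam R m Q \<Longrightarrow> polyfam R (max n m) (\<lambda>i. P i + Q i)"
  unfolding polyfam_def by (auto intro: funring_add)

lemma polyfam_mult:
  assumes "funring R" "polyfam R n P" "polyfam R m Q"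
  shows "polyfam R (n + m) (\<lambda>i. P i * Q i)"
  unfolding polyfam_def
proof (intro conjI allI impI)
  show "(\<lambda>i. coeff (P i * Q i) k) \<in> R" for k
    unfolding coeff_mult
    by (intro funring_sum funring_mult assms(1) polyfam_coeff[OF assms(2)] polyfam_coeff[OF assms(3)])
  show "coeff (P i * Q i) k = 0" if "n + m \<le> k" for k i
    unfolding coeff_mult
  proof (rule sum.neutral, safe)
    fix j assume "j \<le> k"
    with that have "n \<le> j \<or> m \<le> k - j" by linarith
    then show "coeff (P i) j * coeff (Q i) (k - j) = 0"
      using polyfam_coeff_eq_0[OF assms(2)] polyfam_coeff_eq_0[OF assms(3)] by auto
  qed
qed

lemma polyfam_power:
  assumes "funring R" "polyfam R m Q"
  shows "\<exists>m'. polyfam R m' (\<lambda>i. Q i ^ k)"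
proof (induction k)
  case 0
  then show ?case using polyfam_const[OF assms(1) funring_const[OF assms(1)], of 1]
    by (auto simp: one_pCons)
next
  case (Suc k)
  then show ?case using polyfam_mult[OF assms] by auto
qed

lemma polyfam_truncate:
  assumes "funring R" "polyfam R (Suc n) P"
  shows "polyfam R n (\<lambda>i. P i - monom (coeff (P i) n) n)"
  unfolding polyfam_def
proof (intro conjI allI impI)
  show "(\<lambda>i. coeff (P i - monom (coeff (P i) n) n) k) \<in> R" for k
    by (cases "n = k") (use assms polyfam_coeff[OF assms(2)] funring_const in auto)
  show "coeff (P i - monom (coeff (P i) n) n) k = 0" if "n \<le> k" for k i
    using that polyfam_coeff_eq_0[OF assms(2), of k i] by (cases "n = k") auto
qed

lemma polyfam_pseudo_step:
  assumes R: "funring R" and P: "polyfam R (Suc n) P" and S: "polyfam R (Suc m) S" and "n \<le> m"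
  shows "polyfam R m (\<lambda>i. smult (coeff (P i) n) (S i) - monom (coeff (S i) m) (m - n) * P i)"
  unfolding polyfam_def
proof (intro conjI allI impI)
  fix k
  show "(\<lambda>i. coeff (smult (coeff (P i) n) (S i) - monom (coeff (S i) m) (m - n) * P i) k) \<in> R"
    by (cases "k < m - n") (auto simp: coeff_monom_mult intro!: funring_diff funring_mult
        funring_const R polyfam_coeff[OF P] polyfam_coeff[OF S])
  show "coeff (smult (coeff (P i) n) (S i) - monom (coeff (S i) m) (m - n) * P i) k = 0"
    if "m \<le> k" for i
  proof (cases "k = m")
    case True
    then show ?thesis using \<open>n \<le> m\<close> by (simp add: coeff_monom_mult)
  next
    case False
    with that \<open>n \<le> m\<close> have "Suc m \<le> k" "Suc n \<le> k - (m - n)" by auto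
    then show ?thesis
      using polyfam_coeff_eq_0[OF P] polyfam_coeff_eq_0[OF S] by (simp add: coeff_monom_mult)
  qed
qed

lemma polyfam_degree:
  assumes "polyfam R (Suc n) P" "coeff (P i) n \<noteq> 0"
  shows "degree (P i) = n"
  using assms polyfam_coeff_eq_0[OF assms(1)]
  by (intro antisym le_degree degree_le) (auto simp: Suc_le_eq)

lemma constructible_polyfam_nonzero:
  assumes "funring R" "polyfam R n P"
  shows "constructible R (\<lambda>i. P i \<noteq> 0)"
proof -
  have "constructible R (\<lambda>i. \<exists>k<n. coeff (P i) k \<noteq> 0)"
    using assms by (intro constructible_Ex_less constructible_nonzero polyfam_coeff)
  then show ?thesis
  proof (rule back_subst[where P = "constructible R"], intro ext)
    show "(\<exists>k<n. coeff (P i) k \<noteq> 0) = (P i \<noteq> 0)" for i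
      using polyfam_coeff_eq_0[OF assms(2)] by (metis coeff_0 leading_coeff_0_iff not_le)
  qed
qed

text \<open>Where the leading coefficient of P is nonzero, a pseudo-division step does not affect
  divisibility of S by P. Repeating it lowers the bound of S to at most n, that is, its degree below
  that of P, and then divisibility means S = 0.\<close>

lemma constructible_not_dvd:
  assumes R: "funring R" and P: "polyfam R (Suc n) P" and "polyfam R m S"
  shows "constructible R (\<lambda>i. coeff (P i) n \<noteq> 0 \<and> \<not> P i dvd S i)"
  using assms(3)
proof (induction m arbitrary: S)
  have small: "constructible R (\<lambda>i. coeff (P i) n \<noteq> 0 \<and> \<not> P i dvd S i)"
    if "m \<le> n" "polyfam R m S" for m S
  proof -
    have "constructible R (\<lambda>i. coeff (P i) n \<noteq> 0 \<and> S i \<noteq> 0)"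
      using that by (intro constructible_conj_nonzero constructible_polyfam_nonzero R polyfam_coeff[OF P])
    then show ?thesis
    proof (rule back_subst[where P = "constructible R"], intro ext)
      fix i
      have "S i = 0" if "coeff (P i) n \<noteq> 0" "P i dvd S i"
      proof (rule ccontr)
        assume "S i \<noteq> 0"
        with that have "n \<le> degree (S i)"
          using dvd_imp_degree_le polyfam_degree[OF P] by metis
        then have "coeff (S i) (degree (S i)) = 0"
          using \<open>m \<le> n\<close> polyfam_coeff_eq_0[OF \<open>polyfam R m S\<close>] by simp
        with \<open>S i \<noteq> 0\<close> show False by simp
      qed
      then show "(coeff (P i) n \<noteq> 0 \<and> S i \<noteq> 0) = (coeff (P i) n \<noteq> 0 \<and> \<not> P i dvd S i)"
        by auto
    qed
  qed
  {
    case 0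
    then show ?case using small[of 0] by simp
  next
    case (Suc m)
    show ?case
    proof (cases "n \<le> m")
      case True
      define S' where "S' i = smult (coeff (P i) n) (S i) - monom (coeff (S i) m) (m - n) * P i" for i
      have "polyfam R m S'"
        unfolding S'_def by (rule polyfam_pseudo_step[OF R P Suc.prems True])
      then have "constructible R (\<lambda>i. coeff (P i) n \<noteq> 0 \<and> \<not> P i dvd S' i)"
        by (rule Suc.IH)
      then show ?thesis
      proof (rule back_subst[where P = "constructible R"], intro ext)
        fix i
        have "P i dvd S' i \<longleftrightarrow> P i dvd S i" if "coeff (P i) n \<noteq> 0"
        proof -
          have "P i dvd S' i \<longleftrightarrow> P i dvd smult (coeff (P i) n) (S i)"
            unfolding S'_def by (simp add: dvd_diff_left_iff)
          then show ?thesis using that by (simp add: dvd_smult_iff)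
        qed
        then show "(coeff (P i) n \<noteq> 0 \<and> \<not> P i dvd S' i) = (coeff (P i) n \<noteq> 0 \<and> \<not> P i dvd S i)"
          by auto
      qed
    qed (use small[of "Suc m" S] Suc.prems in simp)
  }
qed

text \<open>Over the complex numbers all roots of P are roots of Q iff P divides Q to the power deg
  P. A root of P that Q misses is thus a failure of divisibility.\<close>

lemma constructible_Ex_root_single:
  assumes R: "funring R" and P: "polyfam R (Suc n) P" and Q: "polyfam R m Q"
  shows "constructible R (\<lambda>i. coeff (P i) n \<noteq> 0 \<and> (\<exists>y. poly (P i) y = 0 \<and> poly (Q i) y \<noteq> 0))"
proof -
  obtain m' where "polyfam R m' (\<lambda>i. Q i ^ n)" using polyfam_power[OF R Q] by blast
  from constructible_not_dvd[OF R P this] show ?thesis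
  proof (rule back_subst[where P = "constructible R"], intro ext)
    fix i
    show "(coeff (P i) n \<noteq> 0 \<and> \<not> P i dvd Q i ^ n) =
      (coeff (P i) n \<noteq> 0 \<and> (\<exists>y. poly (P i) y = 0 \<and> poly (Q i) y \<noteq> 0))"
      using nullstellensatz_univariate[of "P i" "Q i"] polyfam_degree[OF P, of i] by auto
  qed
qed

text \<open>Euclid's algorithm, run uniformly in the parameter \<open>i\<close>: the formal degree bounds decrease
  either by dropping a vanishing leading coefficient or by one pseudo-division step.\<close>

lemma constructible_Ex_system:
  fixes L :: "(nat \<times> ('i \<Rightarrow> complex poly)) list"
  assumes R: "funring R" and "\<And>n P. (n, P) \<in> set L \<Longrightarrow> polyfam R n P" and Q: "polyfam R m Q"
  shows "constructible R (\<lambda>i. \<exists>y. (\<forall>(n, P)\<in>set L. poly (P i) y = 0) \<and> poly (Q i) y \<noteq> 0)"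
  using assms(2)
proof (induction "\<Sum>(n, P)\<leftarrow>L. Suc n" arbitrary: L rule: less_induct)
  case less
  define X where "X L i \<longleftrightarrow> (\<exists>y. (\<forall>(n, P)\<in>set L. poly (P i) y = 0) \<and> poly (Q i) y \<noteq> 0)"
    for L :: "(nat \<times> ('i \<Rightarrow> complex poly)) list" and i
  have IH: "constructible R (X L')" if "(\<Sum>(n, P)\<leftarrow>L'. Suc n) < (\<Sum>(n, P)\<leftarrow>L. Suc n)"
    "\<And>n P. (n, P) \<in> set L' \<Longrightarrow> polyfam R n P" for L'
    using less.hyps[OF that] unfolding X_def .
  have drop: "poly (P i) y = 0" if "polyfam R 0 P" for P i y
    using polyfam_coeff_eq_0[OF that, of _ i] by (simp add: poly_altdef)
  \<comment> \<open>The list is described only through its set of members and its size, so this one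
    step serves whichever of the first two polynomials has the smaller bound.\<close>
  have reduce: "constructible R (X L)"
    if L: "set L = insert (Suc n, P) (insert (Suc k, S) (set L'))" and "n \<le> k"
      and sz: "(\<Sum>(n, P)\<leftarrow>L. Suc n) = Suc (Suc n) + (Suc (Suc k) + (\<Sum>(n, P)\<leftarrow>L'. Suc n))" for n P k S L'
  proof (rule constructible_split[OF R])
    have PS: "polyfam R (Suc n) P" "polyfam R (Suc k) S" using less.prems L by auto
    show "(\<lambda>i. coeff (P i) n) \<in> R" using PS by (blast intro: polyfam_coeff)
    show "constructible R (X ((n, \<lambda>i. P i - monom (coeff (P i) n) n) # (Suc k, S) # L'))"
      by (rule IH) (use sz L less.prems polyfam_truncate[OF R PS(1)] in auto)
    show "X L i = X ((n, \<lambda>i. P i - monom (coeff (P i) n) n) # (Suc k, S) # L') i"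
      if "coeff (P i) n = 0" for i using that unfolding X_def L by simp
    define S' where "S' i = smult (coeff (P i) n) (S i) - monom (coeff (S i) k) (k - n) * P i" for i
    have "polyfam R k S'"
      unfolding S'_def by (rule polyfam_pseudo_step[OF R PS \<open>n \<le> k\<close>])
    then have "constructible R (X ((Suc n, P) # (k, S') # L'))"
      by (intro IH) (use sz L less.prems in auto)
    then show "constructible R (\<lambda>i. coeff (P i) n \<noteq> 0 \<and> X ((Suc n, P) # (k, S') # L') i)"
      using PS by (intro constructible_conj_nonzero R) (blast intro: polyfam_coeff)+
    show "X L i = X ((Suc n, P) # (k, S') # L') i" if "coeff (P i) n \<noteq> 0" for i
      using that unfolding X_def L S'_def by (auto 4 4)
  qed
  have "constructible R (X L)"
  \<comment> \<open>The rule is borrowed for its case split only: no equation, one equation, or at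
    least two.\<close>
  proof (cases L rule: remdups_adj.cases)
    case 1
    have "constructible R (\<lambda>i. Q i \<noteq> 0)" by (rule constructible_polyfam_nonzero[OF R Q])
    then show ?thesis
      by (rule back_subst[where P = "constructible R"])
        (use poly_all_0_iff_0 in \<open>auto simp: X_def 1 fun_eq_iff\<close>)
  next
    case (2 x)
    obtain n P where x: "x = (n, P)" by fastforce
    show ?thesis
    proof (cases n)
      case 0
      have "constructible R (X [])" by (rule IH) (use 2 x in auto)
      moreover have "X L = X []" using drop[of P] less.prems unfolding X_def 2 x 0 by auto
      ultimately show ?thesis by simp
    next
      case (Suc n')
      have P: "polyfam R (Suc n') P" using less.prems 2 x Suc by auto
      show ?thesis
      proof (rule constructible_split[OF R])
        show "(\<lambda>i. coeff (P i) n') \<in> R" using P by (rule polyfam_coeff)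
        show "constructible R (X [(n', \<lambda>i. P i - monom (coeff (P i) n') n')])"
          by (rule IH) (use 2 x Suc polyfam_truncate[OF R P] in auto)
        show "X L i = X [(n', \<lambda>i. P i - monom (coeff (P i) n') n')] i"
          if "coeff (P i) n' = 0" for i using that unfolding X_def 2 x by simp
        show "constructible R (\<lambda>i. coeff (P i) n' \<noteq> 0 \<and> (\<exists>y. poly (P i) y = 0 \<and> poly (Q i) y \<noteq> 0))"
          by (rule constructible_Ex_root_single[OF R P Q])
      qed (simp add: X_def 2 x)
    qed
  next
    case (3 x z L')
    obtain n P k S where xz: "x = (n, P)" "z = (k, S)" by fastforce
    consider "n = 0" | "k = 0" | n' k' where "n = Suc n'" "k = Suc k'" by (meson not0_implies_Suc)
    then show ?thesis
    proof cases
      case 1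
      have "constructible R (X (z # L'))" by (rule IH) (use less.prems 3 xz in auto)
      moreover have "X L = X (z # L')" using drop[of P] less.prems unfolding X_def 3 xz 1 by auto
      ultimately show ?thesis by simp
    next
      case 2
      have "constructible R (X (x # L'))" by (rule IH) (use less.prems 3 xz in auto)
      moreover have "X L = X (x # L')" using drop[of S] less.prems unfolding X_def 3 xz 2 by auto
      ultimately show ?thesis by simp
    next
      case c: 3
      show ?thesis
      proof (cases "n' \<le> k'")
        case True
        show ?thesis by (rule reduce[of n' P k' S L']) (use 3 xz c True in auto)
      next
        case False
        show ?thesis by (rule reduce[of k' S n' P L']) (use 3 xz c False in auto)
      qed
    qed
  qed
  then show ?case unfolding X_def .
qed

section \<open>Adjoining a variable and projecting it away\<close>

lemma funring_polyext:
  assumes "funring R"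
  shows "funring (polyext R)"
  unfolding funring_def
proof (intro conjI allI ballI)
  show "(\<lambda>i. c) \<in> polyext R" for c
    unfolding polyext_def using polyfam_const[OF assms funring_const[OF assms], of c]
    by (intro CollectI exI[of _ "\<lambda>i. [:c:]"]) auto
  fix u v assume "u \<in> polyext R" "v \<in> polyext R"
  then obtain P Q n m where u: "u = (\<lambda>(i, y). poly (P i) y)" "polyfam R n P"
    and v: "v = (\<lambda>(i, y). poly (Q i) y)" "polyfam R m Q"
    unfolding polyext_def by blast
  show "(\<lambda>i. u i + v i) \<in> polyext R"
    unfolding polyext_def using polyfam_add[OF assms u(2) v(2)]
    by (intro CollectI exI[of _ "\<lambda>i. P i + Q i"]) (auto simp: u v)
  show "(\<lambda>i. u i * v i) \<in> polyext R"
    unfolding polyext_def using polyfam_mult[OF assms u(2) v(2)]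
    by (intro CollectI exI[of _ "\<lambda>i. P i * Q i"]) (auto simp: u v)
qed

lemma polyext_lift:
  assumes "funring R" "u \<in> R"
  shows "(\<lambda>i. u (fst i)) \<in> polyext R"
  unfolding polyext_def using polyfam_const[OF assms]
  by (intro CollectI exI[of _ "\<lambda>i. [:u i:]"]) auto

lemma polyext_var:
  assumes "funring R"
  shows "snd \<in> polyext R"
  unfolding polyext_def
proof (intro CollectI exI conjI)
  show "polyfam R 2 (\<lambda>i. [:0, 1::complex:])"
    unfolding polyfam_def
    by (auto simp: coeff_pCons intro: funring_const[OF assms] split: nat.split)
  show "snd = (\<lambda>(i, y). poly [:0, 1::complex:] y)" by (simp add: fun_eq_iff)
qed

text \<open>Chevalley's theorem for one variable. The existential quantifier distributes over
  unions, which leaves the basic sets, and these are systems of polynomial equations in y with one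
  inequation.\<close>

lemma constructible_projection:
  assumes R: "funring R" and "constructible (polyext R) S"
  shows "constructible R (\<lambda>i. \<exists>y. S (i, y))"
  using assms(2)
proof induction
  case (basic C q)
  obtain cs where cs: "set cs = C" using \<open>finite C\<close> finite_list by blast
  have "\<forall>c\<in>C. \<exists>x. c = (\<lambda>(i, y). poly (snd x i) y) \<and> polyfam R (fst x) (snd x)"
  proof
    fix c assume "c \<in> C"
    then obtain P n where "c = (\<lambda>(i, y). poly (P i) y)" "polyfam R n P"
      using basic(2) unfolding polyext_def by blast
    then show "\<exists>x. c = (\<lambda>(i, y). poly (snd x i) y) \<and> polyfam R (fst x) (snd x)"
      by (intro exI[of _ "(n, P)"]) simp
  qed
  from bchoice[OF this] obtain F
    where F: "\<forall>c\<in>C. c = (\<lambda>(i, y). poly (snd (F c) i) y) \<and> polyfam R (fst (F c)) (snd (F c))" ..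
  define N Pf where "N c = fst (F c)" and "Pf c = snd (F c)" for c
  have Pf: "c = (\<lambda>(i, y). poly (Pf c i) y)" "polyfam R (N c) (Pf c)" if "c \<in> C" for c
    using F that unfolding N_def Pf_def by blast+
  obtain Q m where Q: "q = (\<lambda>(i, y). poly (Q i) y)" "polyfam R m Q"
    using basic(3) unfolding polyext_def by blast
  have "constructible R (\<lambda>i. \<exists>y. (\<forall>(n, P)\<in>set (map (\<lambda>c. (N c, Pf c)) cs). poly (P i) y = 0)
    \<and> poly (Q i) y \<noteq> 0)"
    by (rule constructible_Ex_system[OF R _ Q(2)]) (use Pf(2) cs in auto)
  then show ?case
  proof (rule back_subst[where P = "constructible R"], intro ext)
    have "c (i, y) = poly (Pf c i) y" if "c \<in> C" for c i y
      using Pf(1)[OF that] by (metis case_prod_conv)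
    then show "(\<exists>y. (\<forall>(n, P)\<in>set (map (\<lambda>c. (N c, Pf c)) cs). poly (P i) y = 0) \<and> poly (Q i) y \<noteq> 0)
      = (\<exists>y. (\<forall>c\<in>C. c (i, y) = 0) \<and> q (i, y) \<noteq> 0)" for i
      by (simp add: cs Q(1))
  qed
next
  case (disj S T)
  from constructible.disj[OF disj.IH] show ?case
    by (rule back_subst[where P = "constructible R"]) auto
qed

section \<open>Generic points and the generic offset\<close>

definition generically :: "(complex \<Rightarrow> complex \<Rightarrow> bool) \<Rightarrow> bool" where
  "generically P \<longleftrightarrow> (\<exists>r::poly2. r \<noteq> 0 \<and> (\<forall>a b. ev2 r a b \<noteq> 0 \<longrightarrow> P a b))"

lemma generically_nonzero: "r \<noteq> 0 \<Longrightarrow> generically (\<lambda>a b. ev2 r a b \<noteq> 0)"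
  by (auto simp: generically_def)

lemma generically_mono: "generically P \<Longrightarrow> (\<And>a b. P a b \<Longrightarrow> Q a b) \<Longrightarrow> generically Q"
  unfolding generically_def by blast

lemma generically_conj:
  assumes "generically P" "generically Q"
  shows "generically (\<lambda>a b. P a b \<and> Q a b)"
proof -
  from assms obtain r s where "r \<noteq> 0" "s \<noteq> 0" "\<And>a b. ev2 r a b \<noteq> 0 \<Longrightarrow> P a b"
    "\<And>a b. ev2 s a b \<noteq> 0 \<Longrightarrow> Q a b"
    unfolding generically_def by blast
  then show ?thesis unfolding generically_def by (intro exI[of _ "r * s"]) auto
qed

lemma generically_True: "generically (\<lambda>a b. True)"
  unfolding generically_def by (intro exI[of _ 1]) auto

lemma generically_ball_finite:
  assumes "finite E" "\<And>x. x \<in> E \<Longrightarrow> generically (P x)"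
  shows "generically (\<lambda>a b. \<forall>x\<in>E. P x a b)"
  using assms
proof (induction E)
  case empty
  then show ?case using generically_True by simp
next
  case (insert x E)
  then show ?case using generically_conj[of "P x" "\<lambda>a b. \<forall>x\<in>E. P x a b"] by simp
qed

definition polyfun3 :: "(complex \<times> complex \<times> complex \<Rightarrow> complex) set" where
  "polyfun3 = range (\<lambda>q (a, b, d). ev3 q a b d)"

lemma polyfun3I: "(\<And>a b d. u (a, b, d) = ev3 q a b d) \<Longrightarrow> u \<in> polyfun3"
  unfolding polyfun3_def by (intro image_eqI[of _ _ q]) (auto simp: fun_eq_iff)

lemma polyfun3E:
  assumes "u \<in> polyfun3"
  obtains q where "u = (\<lambda>(a, b, d). ev3 q a b d)"
  using assms unfolding polyfun3_def by blast

lemma funring_polyfun3: "funring polyfun3"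
  unfolding funring_def
proof (intro conjI allI ballI)
  show "(\<lambda>i. c) \<in> polyfun3" for c
    by (rule polyfun3I[of _ "[:[:[:c:]:]:]"]) simp
  fix u v assume "u \<in> polyfun3" "v \<in> polyfun3"
  then obtain p q where uv: "u = (\<lambda>(a, b, d). ev3 p a b d)" "v = (\<lambda>(a, b, d). ev3 q a b d)"
    by (elim polyfun3E)
  show "(\<lambda>i. u i + v i) \<in> polyfun3" by (rule polyfun3I[of _ "p + q"]) (simp add: uv)
  show "(\<lambda>i. u i * v i) \<in> polyfun3" by (rule polyfun3I[of _ "p * q"]) (simp add: uv)
qed

lemma polyfun3_proj:
  "fst \<in> polyfun3" "(\<lambda>i. fst (snd i)) \<in> polyfun3" "(\<lambda>i. snd (snd i)) \<in> polyfun3"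
  by (rule polyfun3I[of _ "[:[:[:0, 1:]:]:]"] polyfun3I[of _ "[:[:0, 1:]:]"]
      polyfun3I[of _ "[:0, 1:]"], simp)+

text \<open>On the surface \<open>\<pi>\<close> = 0 every polynomial h has a generically constant
  status: it vanishes identically if \<open>\<pi>\<close> divides h, and otherwise the Bezout
  constant excludes common zeros over generic (a, b). The truth value of every equation and
  inequation is therefore generically constant.\<close>

lemma constructible_dichotomy:
  assumes "constructible polyfun3 S" and irr: "irreducible \<pi>" and deg: "degree \<pi> > 0"
  shows "generically (\<lambda>a b. \<forall>d. ev3 \<pi> a b d = 0 \<longrightarrow> S (a, b, d)) \<or>
         generically (\<lambda>a b. \<forall>d. ev3 \<pi> a b d = 0 \<longrightarrow> \<not> S (a, b, d))"
  using assms(1)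
proof induction
  case (basic C q)
  have nz: "generically (\<lambda>a b. \<forall>d. ev3 \<pi> a b d = 0 \<longrightarrow> ev3 h a b d \<noteq> 0)" if "\<not> \<pi> dvd h" for h
  proof -
    from bezout_const_irreducible[OF irr that] obtain A B r
      where r: "r \<noteq> 0" "A * \<pi> + B * h = [:r:]" by blast
    from generically_nonzero[OF r(1)] show ?thesis
    proof (rule generically_mono, intro allI impI notI)
      fix a b d assume *: "ev2 r a b \<noteq> 0" "ev3 \<pi> a b d = 0" "ev3 h a b d = 0"
      have "ev3 (A * \<pi> + B * h) a b d = ev2 r a b" by (simp add: r(2))
      with * show False by simp
    qed
  qed
  obtain k where k: "q = (\<lambda>(a, b, d). ev3 k a b d)"
    using basic(3) by (rule polyfun3E)
  consider (dvd) "\<pi> dvd k"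
    | (ndvd) h where "(\<lambda>(a, b, d). ev3 h a b d) \<in> C" "\<not> \<pi> dvd h"
    | (in_all) "\<not> \<pi> dvd k" "\<And>h. (\<lambda>(a, b, d). ev3 h a b d) \<in> C \<Longrightarrow> \<pi> dvd h"
    by blast
  then show ?case
  proof cases
    case dvd
    then show ?thesis
      by (intro disjI2 generically_mono[OF generically_True]) (auto simp: k elim!: dvdE)
  next
    case ndvd
    then show ?thesis
      using bexI[OF _ ndvd(1), of "\<lambda>c. c _ \<noteq> 0"]
      by (intro disjI2 generically_mono[OF nz[OF ndvd(2)]]) fastforce
  next
    case in_all
    have "c (a, b, d) = 0" if c: "c \<in> C" "ev3 \<pi> a b d = 0" for c a b d
    proof -
      obtain h where h: "c = (\<lambda>(a, b, d). ev3 h a b d)"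
        using basic(2) c(1) by (blast elim: polyfun3E)
      with c(1) in_all(2) have "\<pi> dvd h" by blast
      then show ?thesis using c(2) h by (auto elim!: dvdE)
    qed
    then show ?thesis
      by (intro disjI1 generically_mono[OF nz[OF in_all(1)]]) (auto simp: k)
  qed
next
  case (disj S T)
  show ?case
  proof (cases "generically (\<lambda>a b. \<forall>d. ev3 \<pi> a b d = 0 \<longrightarrow> S (a, b, d)) \<or>
      generically (\<lambda>a b. \<forall>d. ev3 \<pi> a b d = 0 \<longrightarrow> T (a, b, d))")
    case True
    then show ?thesis by (auto elim: generically_mono)
  next
    case False
    with disj.IH have "generically (\<lambda>a b. (\<forall>d. ev3 \<pi> a b d = 0 \<longrightarrow> \<not> S (a, b, d)) \<and>
      (\<forall>d. ev3 \<pi> a b d = 0 \<longrightarrow> \<not> T (a, b, d)))"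
      by (intro generically_conj) auto
    then show ?thesis by (intro disjI2) (auto elim: generically_mono)
  qed
qed

section \<open>The points of the generic offset that come from feet\<close>

abbreviation gsq :: "poly2 \<Rightarrow> complex \<Rightarrow> complex \<Rightarrow> complex" where
  "gsq f a b \<equiv> (ev2 (pd1 f) a b)^2 + (ev2 (pd2 f) a b)^2"

definition feet :: "poly2 \<Rightarrow> complex \<Rightarrow> complex \<Rightarrow> (complex \<times> complex) set" where
  "feet f \<tau>1 \<tau>2 = {(a, b). ev2 f a b = 0 \<and> gsq f a b \<noteq> 0 \<and> nfun f a b \<tau>1 \<tau>2 = 0}"

definition offset_pts :: "poly2 \<Rightarrow> (complex \<times> complex \<times> complex) set" where
  "offset_pts f = {(x1, x2, d). \<exists>(a, b)\<in>feet f x1 x2. bfun a b x1 x2 d = 0}"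

text \<open>The equation w = 0 only says that u is the inverse of f1^2 + f2^2, so projecting u away
  leaves the condition that the foot is not isotropic.\<close>

lemma Omega_projection: "(\<lambda>(y, (x1, x2), d, u). (x1, x2, d)) ` Omega f = offset_pts f"
proof (intro equalityI subsetI)
  fix z assume "z \<in> (\<lambda>(y, (x1, x2), d, u). (x1, x2, d)) ` Omega f"
  then obtain y1 y2 x1 x2 d u where "z = (x1, x2, d)" "((y1, y2), (x1, x2), d, u) \<in> Omega f"
    by auto
  moreover from this have "gsq f y1 y2 \<noteq> 0" unfolding Omega_def wfun_def by auto
  ultimately show "z \<in> offset_pts f"
    unfolding offset_pts_def feet_def Omega_def by blast
next
  fix z assume "z \<in> offset_pts f"
  then obtain x1 x2 d a b where ab: "z = (x1, x2, d)" "ev2 f a b = 0" "gsq f a b \<noteq> 0"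
    "nfun f a b x1 x2 = 0" "bfun a b x1 x2 d = 0"
    unfolding offset_pts_def feet_def by auto
  then have "((a, b), (x1, x2), d, 1 / gsq f a b) \<in> Omega f"
    unfolding Omega_def wfun_def by simp
  then show "z \<in> (\<lambda>(y, (x1, x2), d, u). (x1, x2, d)) ` Omega f"
    using ab(1) by (intro rev_image_eqI) auto
qed

lemma constructible_offset_pts: "constructible polyfun3 (\<lambda>z. z \<in> offset_pts f)"
proof -
  let ?R = "polyext polyfun3"
  let ?R' = "polyext ?R"
  note R = funring_polyfun3 funring_polyext[OF funring_polyfun3]
    funring_polyext[OF funring_polyext[OF funring_polyfun3]]
  \<comment> \<open>The index is nested as ((x, a), b): \<open>fst (fst i)\<close> is the point x =
    (x1, x2, d), and the foot (a, b) occupies the two outer coordinates, which are projected away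
    one after the other.\<close>
  define C where "C = {\<lambda>i. ev2 f (snd (fst i)) (snd i),
    \<lambda>i. nfun f (snd (fst i)) (snd i) (fst (fst (fst i))) (fst (snd (fst (fst i)))),
    \<lambda>i. bfun (snd (fst i)) (snd i) (fst (fst (fst i))) (fst (snd (fst (fst i))))
          (snd (snd (fst (fst i))))}"
  have var: "(\<lambda>i. snd (fst i)) \<in> ?R'" "snd \<in> ?R'"
    using polyext_lift[OF R(2) polyext_var[OF R(1)]] polyext_var[OF R(2)] .
  have lift: "(\<lambda>i. u (fst (fst i))) \<in> ?R'" if "u \<in> polyfun3" for u
    using polyext_lift[OF R(2) polyext_lift[OF R(1) that]] .
  have "constructible ?R' (\<lambda>i. (\<forall>c\<in>C. c i = 0) \<and> gsq f (snd (fst i)) (snd i) \<noteq> 0)"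
  proof (rule basic)
    show "C \<subseteq> ?R'"
      unfolding C_def nfun_def bfun_def
      by (intro insert_subsetI empty_subsetI funring_add funring_diff funring_mult funring_power
          funring_uminus funring_ev2 var lift polyfun3_proj R)
    show "(\<lambda>i. gsq f (snd (fst i)) (snd i)) \<in> ?R'"
      by (intro funring_add funring_power funring_ev2 var R)
  qed (simp add: C_def)
  from constructible_projection[OF R(1) constructible_projection[OF R(2) this]]
  show ?thesis
    by (rule back_subst[where P = "constructible polyfun3"])
      (auto simp: C_def offset_pts_def feet_def fun_eq_iff)
qed

text \<open>Since the zero set of g is the smallest closed set containing the points that come from
  feet, vanishing of h need only be tested at those points.\<close>

lemma generic_offset_eq_vanish:
  assumes "generic_offset_eq f g"
  shows "(x1, x2, d) \<in> offset_pts f \<Longrightarrow> ev3 g x1 x2 d = 0"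
    and "(\<And>x1 x2 d. (x1, x2, d) \<in> offset_pts f \<Longrightarrow> ev3 h x1 x2 d = 0) \<Longrightarrow>
         ev3 g x1 x2 d = 0 \<Longrightarrow> ev3 h x1 x2 d = 0"
proof -
  have eq: "{(x1, x2, d). ev3 g x1 x2 d = 0} = zclosure3 (offset_pts f)"
    using assms unfolding generic_offset_eq_def generic_offset_def Omega_projection by blast
  have "offset_pts f \<subseteq> {(x1, x2, d). ev3 g x1 x2 d = 0}"
    unfolding eq zclosure3_def by blast
  then show "ev3 g x1 x2 d = 0" if "(x1, x2, d) \<in> offset_pts f"
    using that by auto
  show "ev3 h x1 x2 d = 0"
    if "\<And>x1 x2 d. (x1, x2, d) \<in> offset_pts f \<Longrightarrow> ev3 h x1 x2 d = 0" "ev3 g x1 x2 d = 0"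
  proof -
    have "zclosed3 {(x1, x2, d). ev3 h x1 x2 d = 0}"
      unfolding zclosed3_def by (intro exI[of _ "{h}"]) simp
    moreover have "offset_pts f \<subseteq> {(x1, x2, d). ev3 h x1 x2 d = 0}"
      using that(1) by auto
    moreover have "(x1, x2, d) \<in> zclosure3 (offset_pts f)"
      using that(2) eq by blast
    ultimately have "(x1, x2, d) \<in> {(x1, x2, d). ev3 h x1 x2 d = 0}"
      unfolding zclosure3_def by blast
    then show ?thesis by simp
  qed
qed

lemma generic_roots_are_offset_pts:
  assumes g: "generic_offset_eq f g"
  shows "generically (\<lambda>a b. \<forall>d. ev3 g a b d = 0 \<longrightarrow> (a, b, d) \<in> offset_pts f)"
proof -
  have sf: "squarefree g" using g by (simp add: generic_offset_eq_def)
  have "h dvd g \<Longrightarrow> generically (\<lambda>a b. \<forall>d. ev3 h a b d = 0 \<longrightarrow> (a, b, d) \<in> offset_pts f)" for h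
  proof (induction h rule: prime_divisors_induct)
    case zero
    then show ?case using sf by auto
  next
    case (unit h)
    then obtain k where "1 = h * k" by (auto elim: dvdE)
    then have "1 = ev3 h a b d * ev3 k a b d" for a b d
      by (metis ev3_mult ev3_1)
    then have "ev3 h a b d \<noteq> 0" for a b d by (metis mult_zero_left zero_neq_one)
    then show ?case by (intro generically_mono[OF generically_True]) simp
  next
    case (factor \<pi> h)
    have "generically (\<lambda>a b. \<forall>d. ev3 \<pi> a b d = 0 \<longrightarrow> (a, b, d) \<in> offset_pts f)"
    proof (cases "degree \<pi> = 0")
      case True
      then obtain c where c: "\<pi> = [:c:]" by (rule degree_eq_zeroE)
      with factor(1) have "c \<noteq> 0" by auto
      from generically_nonzero[OF this] show ?thesis by (rule generically_mono) (simp add: c)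
    next
      case False
      then have deg: "degree \<pi> > 0" by simp
      have irr: "irreducible \<pi>" using factor(1) by (simp add: prime_elem_imp_irreducible)
      have "\<not> generically (\<lambda>a b. \<forall>d. ev3 \<pi> a b d = 0 \<longrightarrow> (a, b, d) \<notin> offset_pts f)"
      proof
        assume "generically (\<lambda>a b. \<forall>d. ev3 \<pi> a b d = 0 \<longrightarrow> (a, b, d) \<notin> offset_pts f)"
        then obtain r where r: "r \<noteq> 0"
          "\<And>a b d. ev2 r a b \<noteq> 0 \<Longrightarrow> ev3 \<pi> a b d = 0 \<Longrightarrow> (a, b, d) \<notin> offset_pts f"
          unfolding generically_def by blast
        have "\<pi> dvd g" using factor(3) dvd_mult_left by blast
        then obtain k where k: "g = \<pi> * k" by (auto elim: dvdE)
        \<comment> \<open>At a point coming from a foot g = \<open>\<pi> * k\<close> vanishes; if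
          \<open>\<pi>\<close> does, then r must vanish by its choice. So r k vanishes on the whole
          zero set of g, in particular on \<open>\<pi>\<close> = 0. Hence \<open>\<pi>\<close>
          divides r k, and by its degree it divides k, against square-freeness.\<close>
        have "ev3 ([:r:] * k) a b d = 0" if "(a, b, d) \<in> offset_pts f" for a b d
          using generic_offset_eq_vanish(1)[OF g that] r(2)[of a b d] that by (auto simp: k simp del: mult_pCons_left)
        then have "ev3 ([:r:] * k) a b d = 0" if "ev3 \<pi> a b d = 0" for a b d
          using generic_offset_eq_vanish(2)[OF g, of "[:r:] * k" a b d] that by (auto simp: k simp del: mult_pCons_left)
        from irreducible_dvd_if_vanish3[OF irr deg this] have "\<pi> dvd [:r:] * k" .
        moreover have "\<not> \<pi> dvd [:r:]"
          using deg r(1) dvd_imp_degree_le[of \<pi> "[:r:]"] by auto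
        ultimately have "\<pi> dvd k" using prime_dvd_mult_iff[OF factor(1)] by blast
        then have "\<pi>\<^sup>2 dvd g" by (simp add: k power2_eq_square)
        then show False using sf factor(1) squarefreeD not_prime_unit by blast
      qed
      with constructible_dichotomy[OF constructible_offset_pts irr deg, of f] show ?thesis by blast
    qed
    moreover have "h dvd g" using factor(3) dvd_mult_right by blast
    ultimately have "generically (\<lambda>a b. (\<forall>d. ev3 \<pi> a b d = 0 \<longrightarrow> (a, b, d) \<in> offset_pts f) \<and>
      (\<forall>d. ev3 h a b d = 0 \<longrightarrow> (a, b, d) \<in> offset_pts f))"
      using factor(2) by (intro generically_conj)
    then show ?case by (rule generically_mono) auto
  qed
  from this[OF dvd_refl] show ?thesis .
qed

section \<open>Recovering the foot from the gradient\<close>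

lemma ev2_has_field_derivative:
  assumes "(X has_field_derivative X') (at z)" "(Y has_field_derivative Y') (at z)"
  shows "((\<lambda>z. ev2 p (X z) (Y z)) has_field_derivative
    ev2 (pd1 p) (X z) (Y z) * X' + ev2 (pd2 p) (X z) (Y z) * Y') (at z)"
proof (induction p)
  case 0
  then show ?case by (simp add: pd1_def pd2_def)
next
  case (pCons c p)
  have "((\<lambda>z. poly c (X z) + Y z * ev2 p (X z) (Y z)) has_field_derivative
     poly (pderiv c) (X z) * X' + (Y' * ev2 p (X z) (Y z) +
     (ev2 (pd1 p) (X z) (Y z) * X' + ev2 (pd2 p) (X z) (Y z) * Y') * Y z)) (at z)"
    by (intro DERIV_add DERIV_mult DERIV_chain2[OF poly_DERIV] assms pCons.IH)
  then show ?case
    by (simp add: pd1_def pd2_def map_poly_pCons pderiv_pCons algebra_simps)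
qed

lemma ev3_has_field_derivative:
  assumes "(X has_field_derivative X') (at z)" "(Y has_field_derivative Y') (at z)"
    "(Z has_field_derivative Z') (at z)"
  shows "((\<lambda>z. ev3 p (X z) (Y z) (Z z)) has_field_derivative
    ev3 (map_poly pd1 p) (X z) (Y z) (Z z) * X' + ev3 (map_poly pd2 p) (X z) (Y z) (Z z) * Y'
    + ev3 (pderiv p) (X z) (Y z) (Z z) * Z') (at z)"
proof (induction p)
  case 0
  then show ?case by simp
next
  case (pCons c p)
  have 0: "pd1 0 = 0" "pd2 0 = 0" by (simp_all add: pd1_def pd2_def)
  have "((\<lambda>z. ev2 c (X z) (Y z) + Z z * ev3 p (X z) (Y z) (Z z)) has_field_derivative
     (ev2 (pd1 c) (X z) (Y z) * X' + ev2 (pd2 c) (X z) (Y z) * Y') +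
     (Z' * ev3 p (X z) (Y z) (Z z) +
     (ev3 (map_poly pd1 p) (X z) (Y z) (Z z) * X' + ev3 (map_poly pd2 p) (X z) (Y z) (Z z) * Y'
    + ev3 (pderiv p) (X z) (Y z) (Z z) * Z') * Z z)) (at z)"
    by (intro DERIV_add DERIV_mult ev2_has_field_derivative assms pCons.IH)
  then show ?case
    by (simp add: 0 map_poly_pCons pderiv_pCons algebra_simps)
qed

text \<open>Multiplication by d exchanges the two parts and turns d * d into a shift in the variable
  d^2, hence the witnesses \<open>pCons c g1\<close> and \<open>g0\<close>.\<close>

lemma ev3_even_odd_split:
  "\<exists>g0 g1. \<forall>a b d. ev3 g a b d = ev3 g0 a b (d\<^sup>2) + d * ev3 g1 a b (d\<^sup>2)"
proof (induction g)
  case 0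
  then show ?case by (intro exI[of _ 0]) simp
next
  case (pCons c g)
  then obtain g0 g1 where "\<And>a b d. ev3 g a b d = ev3 g0 a b (d\<^sup>2) + d * ev3 g1 a b (d\<^sup>2)"
    by blast
  then show ?case
    by (intro exI[of _ "pCons c g1"] exI[of _ g0]) (simp add: algebra_simps power2_eq_square)
qed

text \<open>The closure rules of \<open>funring\<close> are reused to recognise an expression along
  a normal line as a polynomial in its parameter t. An identity can then be extended over
  exceptional t, or a factor cancelled.\<close>

lemma funring_poly1: "funring (range poly)"
  unfolding funring_def
proof (intro conjI allI ballI)
  show "(\<lambda>i. c) \<in> range poly" for c :: complex
    by (rule image_eqI[of _ _ "[:c:]"]) auto
  fix u v :: "complex \<Rightarrow> complex" assume "u \<in> range poly" "v \<in> range poly"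
  then obtain p q where uv: "u = poly p" "v = poly q" by blast
  show "(\<lambda>i. u i + v i) \<in> range poly" by (rule image_eqI[of _ _ "p + q"]) (auto simp: uv)
  show "(\<lambda>i. u i * v i) \<in> range poly" by (rule image_eqI[of _ _ "p * q"]) (auto simp: uv)
qed

lemma ident_in_range_poly: "(\<lambda>t::complex. t) \<in> range poly"
  by (rule image_eqI[of _ _ "[:0, 1::complex:]"]) auto

lemma poly_eq_0_if_zero_off_finite:
  fixes p :: "complex poly"
  assumes "finite A" "\<And>t. t \<notin> A \<Longrightarrow> poly p t = 0"
  shows "p = 0"
proof (rule ccontr)
  assume "p \<noteq> 0"
  then have "finite (A \<union> {t. poly p t = 0})" using assms(1) poly_roots_finite by blast
  moreover have "A \<union> {t. poly p t = 0} = UNIV" using assms(2) by auto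
  ultimately show False using infinite_UNIV_char_0[where 'a = complex] by simp
qed

definition polyfun2 :: "(complex \<times> complex \<Rightarrow> complex) set" where
  "polyfun2 = range (\<lambda>p (x, y). ev2 p x y)"

lemma polyfun2I: "(\<And>a b. u (a, b) = ev2 p a b) \<Longrightarrow> u \<in> polyfun2"
  unfolding polyfun2_def by (intro image_eqI[of _ _ p]) (auto simp: fun_eq_iff)

lemma polyfun2E:
  assumes "u \<in> polyfun2"
  obtains p where "u = (\<lambda>(a, b). ev2 p a b)"
  using assms unfolding polyfun2_def by blast

lemma funring_polyfun2: "funring polyfun2"
  unfolding funring_def
proof (intro conjI allI ballI)
  show "(\<lambda>i. c) \<in> polyfun2" for c
    by (rule polyfun2I[of _ "[:[:c:]:]"]) simp
  fix u v assume "u \<in> polyfun2" "v \<in> polyfun2"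
  then obtain p q where uv: "u = (\<lambda>(x, y). ev2 p x y)" "v = (\<lambda>(x, y). ev2 q x y)"
    by (elim polyfun2E)
  show "(\<lambda>i. u i + v i) \<in> polyfun2" by (rule polyfun2I[of _ "p + q"]) (simp add: uv)
  show "(\<lambda>i. u i * v i) \<in> polyfun2" by (rule polyfun2I[of _ "p * q"]) (simp add: uv)
qed

text \<open>Differentiate \<open>H(p + t \<nabla>f(p), t\<^sup>2 |\<nabla>f(p)|\<^sup>2) = 0\<close> in \<open>t\<close> and along the curve. With \<open>s = |\<nabla>f|\<^sup>2\<close>,
  the second equation reduces to \<open>(s + t k) (- f\<^sub>2 H\<^sub>1 + f\<^sub>1 H\<^sub>2) = 0\<close>, where \<open>k\<close> does not depend
  on \<open>t\<close>; as this holds for all \<open>t\<close>, the factor \<open>s + t k\<close>, which vanishes at the focal point, can be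
  cancelled.\<close>

lemma gradient_along_normal:
  fixes f :: poly2 and H :: poly3
  assumes irr: "irreducible f" and deg: "degree f > 0"
    and van: "\<And>x y t. ev2 f x y = 0 \<Longrightarrow> gsq f x y \<noteq> 0 \<Longrightarrow>
      ev3 H (x + t * ev2 (pd1 f) x y) (y + t * ev2 (pd2 f) x y) (t\<^sup>2 * gsq f x y) = 0"
    and ab: "ev2 f a b = 0" "gsq f a b \<noteq> 0"
    and X: "X = a + t * ev2 (pd1 f) a b" and Y: "Y = b + t * ev2 (pd2 f) a b"
    and E: "E = t\<^sup>2 * gsq f a b"
  shows "ev3 (map_poly pd1 H) X Y E = - 2 * ev3 (pderiv H) X Y E * (X - a)"
    and "ev3 (map_poly pd2 H) X Y E = - 2 * ev3 (pderiv H) X Y E * (Y - b)"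
proof -
  define f1 f2 s where "f1 = ev2 (pd1 f) a b" and "f2 = ev2 (pd2 f) a b" and "s = gsq f a b"
  have s: "s = f1\<^sup>2 + f2\<^sup>2" "s \<noteq> 0" using ab(2) by (simp_all add: s_def f1_def f2_def)
  define H1 H2 H3 where "H1 t = ev3 (map_poly pd1 H) (a + t * f1) (b + t * f2) (t\<^sup>2 * s)"
    and "H2 t = ev3 (map_poly pd2 H) (a + t * f1) (b + t * f2) (t\<^sup>2 * s)"
    and "H3 t = ev3 (pderiv H) (a + t * f1) (b + t * f2) (t\<^sup>2 * s)" for t
  \<comment> \<open>Derivatives of f1 and f2 at (a, b) in the tangent direction (-f2, f1).\<close>
  define v1 v2 where "v1 = ev2 (pd1 (pd1 f)) a b * (- f2) + ev2 (pd2 (pd1 f)) a b * f1"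
    and "v2 = ev2 (pd1 (pd2 f)) a b * (- f2) + ev2 (pd2 (pd2 f)) a b * f1"
  have normal: "H1 t * f1 + H2 t * f2 + H3 t * (2 * t * s) = 0" for t
  proof -
    have "((\<lambda>t. ev3 H (a + t * f1) (b + t * f2) (t\<^sup>2 * s)) has_field_derivative
      H1 t * f1 + H2 t * f2 + H3 t * (2 * t * s)) (at t)"
      unfolding H1_def H2_def H3_def
      by (intro ev3_has_field_derivative) (auto intro!: derivative_eq_intros)
    moreover have "(\<lambda>t. ev3 H (a + t * f1) (b + t * f2) (t\<^sup>2 * s)) = (\<lambda>t. 0)"
      using van[OF ab] by (auto simp: f1_def f2_def s_def)
    ultimately show ?thesis using DERIV_unique[OF _ DERIV_const] by metis
  qed
  have tangent: "H1 t * (- f2 + t * v1) + H2 t * (f1 + t * v2)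
    + H3 t * (t\<^sup>2 * (2 * f1 * v1 + 2 * f2 * v2)) = 0" for t
  proof -
    have fs: "fst \<in> polyfun2" "snd \<in> polyfun2"
      by (rule polyfun2I[of _ "[:[:0, 1:]:]"] polyfun2I[of _ "[:0, 1:]"], simp)+
    have "(\<lambda>i. ev3 H (fst i + t * ev2 (pd1 f) (fst i) (snd i)) (snd i + t * ev2 (pd2 f) (fst i) (snd i))
        (t\<^sup>2 * gsq f (fst i) (snd i))) \<in> polyfun2"
      by (intro funring_ev3 funring_add funring_mult funring_power funring_ev2 funring_const
          funring_polyfun2 fs)
    then obtain q where q: "\<And>x y. ev2 q x y =
        ev3 H (x + t * ev2 (pd1 f) x y) (y + t * ev2 (pd2 f) x y) (t\<^sup>2 * gsq f x y)"
      by (rule polyfun2E) (auto simp: fun_eq_iff)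
    \<comment> \<open>q is known to vanish only at the non-isotropic points of the curve.
      Multiplication by S extends this to the whole curve; S is cancelled again because it is
      nonzero at (a, b).\<close>
    define S where "S = (pd1 f)\<^sup>2 + (pd2 f)\<^sup>2"
    have "f dvd q * S"
      by (rule irreducible_dvd_if_vanish[OF irr deg]) (use van in \<open>auto simp: q S_def\<close>)
    moreover have "ev2 S a b \<noteq> 0" using ab(2) by (simp add: S_def)
    then have "\<not> f dvd S" using ab(1) by (metis dvdE ev2_mult mult_zero_left)
    ultimately have "f dvd q"
      using irr by (simp add: prime_elem_iff_irreducible[symmetric] prime_elem_dvd_mult_iff)
    then obtain k where k: "q = f * k" by (auto elim: dvdE)
    \<comment> \<open>A straight tangent line can replace the curve: q is a multiple f k of f, and
      at (a, b) both f and its derivative in the direction (-f2, f1) vanish, so the derivative of f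
      k is 0.\<close>
    let ?x = "\<lambda>z. a - z * f2" and ?y = "\<lambda>z. b + z * f1"
    have dx: "(?x has_field_derivative - f2) (at 0)" and dy: "(?y has_field_derivative f1) (at 0)"
      by (auto intro!: derivative_eq_intros)
    have df1: "((\<lambda>z. ev2 (pd1 f) (?x z) (?y z)) has_field_derivative v1) (at 0)"
      and df2: "((\<lambda>z. ev2 (pd2 f) (?x z) (?y z)) has_field_derivative v2) (at 0)"
      using ev2_has_field_derivative[OF dx dy, of "pd1 f"] ev2_has_field_derivative[OF dx dy, of "pd2 f"]
      by (simp_all add: v1_def v2_def)
    have "((\<lambda>z. ev3 H (?x z + t * ev2 (pd1 f) (?x z) (?y z)) (?y z + t * ev2 (pd2 f) (?x z) (?y z))
        (t\<^sup>2 * gsq f (?x z) (?y z))) has_field_derivative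
        H1 t * (- f2 + t * v1) + H2 t * (f1 + t * v2) + H3 t * (t\<^sup>2 * (2 * f1 * v1 + 2 * f2 * v2))) (at 0)"
    proof -
      have "((\<lambda>z. t\<^sup>2 * gsq f (?x z) (?y z)) has_field_derivative
        t\<^sup>2 * (2 * f1 * v1 + 2 * f2 * v2)) (at 0)"
        using DERIV_cmult[OF DERIV_add[OF DERIV_power[OF df1, of 2] DERIV_power[OF df2, of 2]], of "t\<^sup>2"]
        by (simp add: f1_def[symmetric] f2_def[symmetric] mult_ac)
      from ev3_has_field_derivative[OF DERIV_add[OF dx DERIV_cmult[OF df1, of t]]
          DERIV_add[OF dy DERIV_cmult[OF df2, of t]] this, of H]
      show ?thesis by (simp add: H1_def H2_def H3_def f1_def f2_def s_def)
    qed
    moreover have "((\<lambda>z. ev3 H (?x z + t * ev2 (pd1 f) (?x z) (?y z)) (?y z + t * ev2 (pd2 f) (?x z) (?y z))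
        (t\<^sup>2 * gsq f (?x z) (?y z))) has_field_derivative 0) (at 0)"
    proof -
      have "((\<lambda>z. ev2 f (?x z) (?y z) * ev2 k (?x z) (?y z)) has_field_derivative 0) (at 0)"
        using DERIV_mult[OF ev2_has_field_derivative[OF dx dy, of f] ev2_has_field_derivative[OF dx dy, of k]]
        by (simp add: ab(1) f1_def f2_def)
      then show ?thesis by (simp add: q[symmetric] k)
    qed
    ultimately show ?thesis by (rule DERIV_unique)
  qed
  define \<kappa> where "\<kappa> = f1 * v2 - f2 * v1"
  have prod: "(- f2 * H1 t + f1 * H2 t) * (s + t * \<kappa>) = 0" for t
  proof -
    \<comment> \<open>The combination is chosen so that \<open>H3 t\<close> cancels.\<close>
    have "(- f2 * H1 t + f1 * H2 t) * (s + t * \<kappa>) =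
      s * (H1 t * (- f2 + t * v1) + H2 t * (f1 + t * v2)
        + H3 t * (t\<^sup>2 * (2 * f1 * v1 + 2 * f2 * v2)))
      - t * (f1 * v1 + f2 * v2) * (H1 t * f1 + H2 t * f2 + H3 t * (2 * t * s))"
      unfolding \<kappa>_def s(1) by (simp add: algebra_simps power2_eq_square)
    then show ?thesis unfolding normal tangent by simp
  qed
  have "(\<lambda>t. - f2 * H1 t + f1 * H2 t) \<in> range poly"
    unfolding H1_def H2_def
    by (intro funring_ev3 funring_add funring_mult funring_power funring_const funring_poly1 ident_in_range_poly)
  then obtain p where p: "\<And>t. poly p t = - f2 * H1 t + f1 * H2 t" by (auto simp: fun_eq_iff)
  have "p * [:s, \<kappa>:] = 0"
  proof (rule poly_eq_0_if_zero_off_finite[of "{}"])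
    have "poly (p * [:s, \<kappa>:]) t = (- f2 * H1 t + f1 * H2 t) * (s + t * \<kappa>)" for t
      by (simp only: poly_mult p poly_pCons poly_0 mult_zero_right add_0_right)
    then show "poly (p * [:s, \<kappa>:]) t = 0" for t by (simp only: prod)
  qed simp
  then have "p = 0" using s(2) by (simp only: mult_eq_0_iff pCons_eq_0_iff simp_thms)
  then have tan0: "- f2 * H1 t + f1 * H2 t = 0" using p by (metis poly_0)
  have n: "H1 t * f1 + H2 t * f2 = - 2 * H3 t * t * s" using normal[of t] by algebra
  have "s * H1 t = s * (- 2 * H3 t * (t * f1))" using n tan0 s(1) by algebra
  moreover have "s * H2 t = s * (- 2 * H3 t * (t * f2))" using n tan0 s(1) by algebra
  ultimately have "H1 t = - 2 * H3 t * (t * f1)" "H2 t = - 2 * H3 t * (t * f2)"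
    using s(2) by (simp_all only: mult_cancel_left simp_thms)
  then show "ev3 (map_poly pd1 H) X Y E = - 2 * ev3 (pderiv H) X Y E * (X - a)"
    and "ev3 (map_poly pd2 H) X Y E = - 2 * ev3 (pderiv H) X Y E * (Y - b)"
    by (simp_all add: X Y E H1_def H2_def H3_def f1_def f2_def s_def)
qed

lemma feet_param:
  assumes "(a, b) \<in> feet f x1 x2"
  shows "\<exists>t. x1 = a + t * ev2 (pd1 f) a b \<and> x2 = b + t * ev2 (pd2 f) a b \<and>
    (x1 - a)\<^sup>2 + (x2 - b)\<^sup>2 = t\<^sup>2 * gsq f a b"
proof -
  let ?f1 = "ev2 (pd1 f) a b" and ?f2 = "ev2 (pd2 f) a b"
  \<comment> \<open>The equation \<open>nfun\<close> = 0 makes tau - p parallel to the gradient of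
    f; t is the coefficient, obtained as the scalar product with the gradient divided by its
    square.\<close>
  define t where "t = ((x1 - a) * ?f1 + (x2 - b) * ?f2) / gsq f a b"
  have s: "gsq f a b \<noteq> 0" and n: "- ?f2 * (x1 - a) + ?f1 * (x2 - b) = 0"
    using assms by (simp_all add: feet_def nfun_def)
  have t: "t * gsq f a b = (x1 - a) * ?f1 + (x2 - b) * ?f2" using s by (simp add: t_def)
  have "gsq f a b * (x1 - a) = gsq f a b * (t * ?f1)" using t n by algebra
  then have 1: "x1 - a = t * ?f1" using s by (simp only: mult_cancel_left simp_thms)
  have "gsq f a b * (x2 - b) = gsq f a b * (t * ?f2)" using t n by algebra
  then have 2: "x2 - b = t * ?f2" using s by (simp only: mult_cancel_left simp_thms)
  show ?thesis
  proof (intro exI conjI)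
    show "x1 = a + t * ?f1" "x2 = b + t * ?f2" using 1 2 by (simp_all add: algebra_simps)
    show "(x1 - a)\<^sup>2 + (x2 - b)\<^sup>2 = t\<^sup>2 * gsq f a b"
      unfolding 1 2 by (simp add: algebra_simps)
  qed
qed

text \<open>For t different from 0 both square roots d and -d of the squared distance are zeros of
  g, and adding and subtracting the two equations separates the parts since d is nonzero. A
  polynomial in t that vanishes off 0 is zero, which covers t = 0.\<close>

lemma even_odd_parts_vanish:
  assumes g: "generic_offset_eq f g"
    and split: "\<And>a b d. ev3 g a b d = ev3 g0 a b (d\<^sup>2) + d * ev3 g1 a b (d\<^sup>2)"
    and xy: "ev2 f x y = 0" "gsq f x y \<noteq> 0"
    and H: "H = g0 \<or> H = g1"
  shows "ev3 H (x + t * ev2 (pd1 f) x y) (y + t * ev2 (pd2 f) x y) (t\<^sup>2 * gsq f x y) = 0"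
proof -
  let ?X = "\<lambda>t. x + t * ev2 (pd1 f) x y" and ?Y = "\<lambda>t. y + t * ev2 (pd2 f) x y"
    and ?E = "\<lambda>t. t\<^sup>2 * gsq f x y"
  have nonzero: "ev3 H (?X t) (?Y t) (?E t) = 0" if "t \<noteq> 0" for t
  proof -
    define d where "d = csqrt (?E t)"
    have d: "d\<^sup>2 = ?E t" "d \<noteq> 0" using that xy(2) by (auto simp: d_def)
    have "(x, y) \<in> feet f (?X t) (?Y t)"
      using xy by (simp add: feet_def nfun_def)
    moreover have "bfun x y (?X t) (?Y t) e = 0" if "e\<^sup>2 = ?E t" for e
      unfolding bfun_def that by (simp add: algebra_simps)
    ultimately have pt: "(?X t, ?Y t, e) \<in> offset_pts f" if "e\<^sup>2 = ?E t" for e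
      unfolding offset_pts_def using that by blast
    have "(?X t, ?Y t, d) \<in> offset_pts f" "(?X t, ?Y t, - d) \<in> offset_pts f"
      by (rule pt, simp add: d(1))+
    then have "ev3 g (?X t) (?Y t) d = 0" "ev3 g (?X t) (?Y t) (- d) = 0"
      using generic_offset_eq_vanish(1)[OF g] by blast+
    then have "ev3 g0 (?X t) (?Y t) (?E t) + d * ev3 g1 (?X t) (?Y t) (?E t) = 0"
      "ev3 g0 (?X t) (?Y t) (?E t) - d * ev3 g1 (?X t) (?Y t) (?E t) = 0"
      unfolding split by (simp_all add: d(1))
    then have "ev3 g0 (?X t) (?Y t) (?E t) = 0" "d * ev3 g1 (?X t) (?Y t) (?E t) = 0"
      by algebra+
    then show ?thesis using H d(2) by auto
  qed
  have "(\<lambda>t. ev3 H (?X t) (?Y t) (?E t)) \<in> range poly"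
    by (intro funring_ev3 funring_add funring_mult funring_power funring_const funring_poly1 ident_in_range_poly)
  then obtain p where p: "\<And>t. poly p t = ev3 H (?X t) (?Y t) (?E t)" by (auto simp: fun_eq_iff)
  have "p = 0"
    by (rule poly_eq_0_if_zero_off_finite[of "{0}"]) (use nonzero in \<open>auto simp: p\<close>)
  then show ?thesis using p by (metis poly_0)
qed

text \<open>Both parts vanish at E, so the d-derivative of g at a square root d of E combines only
  their E-derivatives. As it is nonzero, some part H has a nonzero E-derivative, and the gradient
  formula recovers the foot as tau + (H1, H2) / (2 H3), an expression in tau and E alone.\<close>

lemma inj_on_sqdist_feet:
  assumes irr: "irreducible f" and deg: "degree f > 0" and g: "generic_offset_eq f g"
    and simple: "\<And>d. ev3 g x1 x2 d = 0 \<Longrightarrow> ev3 (pderiv g) x1 x2 d \<noteq> 0"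
  shows "inj_on (\<lambda>(a, b). (a - x1)\<^sup>2 + (b - x2)\<^sup>2) (feet f x1 x2)"
proof -
  obtain g0 g1 where split: "\<And>a b d. ev3 g a b d = ev3 g0 a b (d\<^sup>2) + d * ev3 g1 a b (d\<^sup>2)"
    using ev3_even_odd_split by blast
  have foot_eq: "ev3 (map_poly pd1 H) x1 x2 E = - 2 * ev3 (pderiv H) x1 x2 E * (x1 - a) \<and>
      ev3 (map_poly pd2 H) x1 x2 E = - 2 * ev3 (pderiv H) x1 x2 E * (x2 - b) \<and>
      ev3 H x1 x2 E = 0"
    if ab: "(a, b) \<in> feet f x1 x2" and E: "E = (a - x1)\<^sup>2 + (b - x2)\<^sup>2"
      and H: "H = g0 \<or> H = g1" for H a b E
  proof -
    from feet_param[OF ab] obtain t where xt: "x1 = a + t * ev2 (pd1 f) a b"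
      "x2 = b + t * ev2 (pd2 f) a b" "(x1 - a)\<^sup>2 + (x2 - b)\<^sup>2 = t\<^sup>2 * gsq f a b" by blast
    have "E = t\<^sup>2 * gsq f a b"
      using xt(3) unfolding E by (simp only: power2_commute[of a x1] power2_commute[of b x2])
    note t = xt(1,2) this
    have ab': "ev2 f a b = 0" "gsq f a b \<noteq> 0" using ab by (auto simp: feet_def)
    note van = even_odd_parts_vanish[OF g split _ _ H]
    show ?thesis
      using gradient_along_normal[OF irr deg van ab' t] van[OF ab', of t] t by simp
  qed
  show ?thesis
  proof (rule inj_onI, safe)
    fix a b a' b'
    assume ab: "(a, b) \<in> feet f x1 x2" and ab': "(a', b') \<in> feet f x1 x2"
      and eq: "(a - x1)\<^sup>2 + (b - x2)\<^sup>2 = (a' - x1)\<^sup>2 + (b' - x2)\<^sup>2"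
    define E where "E = (a - x1)\<^sup>2 + (b - x2)\<^sup>2"
    define d where "d = csqrt E"
    have d: "d\<^sup>2 = E" by (simp add: d_def)
    have E': "E = (a' - x1)\<^sup>2 + (b' - x2)\<^sup>2" by (simp add: E_def eq)
    have zero: "ev3 g0 x1 x2 E = 0" "ev3 g1 x1 x2 E = 0" using foot_eq[OF ab E_def] by auto
    then have "ev3 g x1 x2 d = 0" by (simp add: split d)
    then have nz: "ev3 (pderiv g) x1 x2 d \<noteq> 0" by (rule simple)
    have D: "((\<lambda>z. ev3 p x1 x2 (z\<^sup>2)) has_field_derivative ev3 (pderiv p) x1 x2 (d\<^sup>2) * (2 * d)) (at d)" for p
      using ev3_has_field_derivative[OF DERIV_const DERIV_const DERIV_power[OF DERIV_ident[of "at d"], of 2], of p x1 x2] by simp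
    have "((\<lambda>z. ev3 g0 x1 x2 (z\<^sup>2) + z * ev3 g1 x1 x2 (z\<^sup>2)) has_field_derivative
      ev3 (pderiv g0) x1 x2 (d\<^sup>2) * (2 * d) +
      (1 * ev3 g1 x1 x2 (d\<^sup>2) + (ev3 (pderiv g1) x1 x2 (d\<^sup>2) * (2 * d)) * d)) (at d)"
      by (intro DERIV_add DERIV_mult D DERIV_ident)
    moreover have "((\<lambda>z. ev3 g0 x1 x2 (z\<^sup>2) + z * ev3 g1 x1 x2 (z\<^sup>2)) has_field_derivative
      ev3 (pderiv g) x1 x2 d) (at d)"
      using ev3_has_field_derivative[OF DERIV_const DERIV_const DERIV_ident, of g x1 x2 d]
      by (simp add: split)
    ultimately have "ev3 (pderiv g) x1 x2 d = ev3 (pderiv g0) x1 x2 E * (2 * d) +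
      (1 * ev3 g1 x1 x2 E + (ev3 (pderiv g1) x1 x2 E * (2 * d)) * d)"
      unfolding d using DERIV_unique by blast
    then have "ev3 (pderiv g0) x1 x2 E \<noteq> 0 \<or> ev3 (pderiv g1) x1 x2 E \<noteq> 0"
      using nz zero by auto
    then obtain H where H: "H = g0 \<or> H = g1" "ev3 (pderiv H) x1 x2 E \<noteq> 0" by blast
    have "ev3 (pderiv H) x1 x2 E * (x1 - a) = ev3 (pderiv H) x1 x2 E * (x1 - a')"
      "ev3 (pderiv H) x1 x2 E * (x2 - b) = ev3 (pderiv H) x1 x2 E * (x2 - b')"
      using foot_eq[OF ab E_def H(1)] foot_eq[OF ab' E' H(1)] by auto
    then show "a = a'" "b = b'" using H(2) by auto
  qed
qed

section \<open>Counting roots over a generic point\<close>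

lemma generic_roots_simple:
  assumes "squarefree g"
  shows "generically (\<lambda>a b. \<forall>d. ev3 g a b d = 0 \<longrightarrow> ev3 (pderiv g) a b d \<noteq> 0)"
proof -
  obtain A B r where r: "r \<noteq> 0" "A * g + B * pderiv g = [:r:]"
    using bezout_const_squarefree_pderiv[OF assms] by blast
  from generically_nonzero[OF r(1)] show ?thesis
  proof (rule generically_mono, intro allI impI notI)
    fix a b d assume *: "ev2 r a b \<noteq> 0" "ev3 g a b d = 0" "ev3 (pderiv g) a b d = 0"
    have "ev3 (A * g + B * pderiv g) a b d = ev2 r a b" by (simp add: r(2))
    with * show False by simp
  qed
qed

lemma card_simple_roots:
  assumes lc: "ev2 (lead_coeff g) a b \<noteq> 0"
    and simple: "\<And>d. ev3 g a b d = 0 \<Longrightarrow> ev3 (pderiv g) a b d \<noteq> 0"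
  shows "card {d. ev3 g a b d = 0} = degree g" "finite {d. ev3 g a b d = 0}"
proof -
  define p where "p = map_poly (\<lambda>q. ev2 q a b) g"
  have p: "poly p d = ev3 g a b d" for d by (simp add: p_def ev3_def)
  have degp: "degree p = degree g"
    unfolding p_def using lc by (rule map_poly_degree_eq)
  have "p \<noteq> 0" using lc unfolding p_def by (metis coeff_0 coeff_map_poly ev2_0)
  have "poly (pderiv p) d = ev3 (pderiv g) a b d" for d
  proof (rule DERIV_unique)
    show "(poly p has_field_derivative poly (pderiv p) d) (at d)" by (rule poly_DERIV)
    show "(poly p has_field_derivative ev3 (pderiv g) a b d) (at d)"
      using ev3_has_field_derivative[OF DERIV_const DERIV_const DERIV_ident, of g a b d]
      by (simp add: p[abs_def])
  qed
  then have "rsquarefree p" using simple by (auto simp: rsquarefree_roots p)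
  from complex_poly_decompose_rsquarefree[OF this]
  have "degree p = degree (smult (lead_coeff p) (\<Prod>z | poly p z = 0. [:- z, 1:]))" by simp
  also have "\<dots> = card {z. poly p z = 0}"
    using \<open>p \<noteq> 0\<close> by (simp add: degree_prod_sum_eq)
  finally show "card {d. ev3 g a b d = 0} = degree g" by (simp add: degp p)
  show "finite {d. ev3 g a b d = 0}" using poly_roots_finite[OF \<open>p \<noteq> 0\<close>] by (simp add: p)
qed

lemma generic_no_special_feet:
  assumes "finite E"
  shows "generically (\<lambda>x1 x2. \<forall>(a, b)\<in>E. (ev2 (pd1 f) a b, ev2 (pd2 f) a b) \<noteq> (0, 0) \<longrightarrow>
    nfun f a b x1 x2 \<noteq> 0)"
proof (rule generically_ball_finite[OF assms])
  fix p assume "p \<in> E"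
  obtain a b where p: "p = (a, b)" by fastforce
  let ?f1 = "ev2 (pd1 f) a b" and ?f2 = "ev2 (pd2 f) a b"
  show "generically (\<lambda>x1 x2. case p of (a, b) \<Rightarrow>
      (ev2 (pd1 f) a b, ev2 (pd2 f) a b) \<noteq> (0, 0) \<longrightarrow> nfun f a b x1 x2 \<noteq> 0)"
  proof (cases "(?f1, ?f2) = (0, 0)")
    case True
    then show ?thesis by (intro generically_mono[OF generically_True]) (auto simp: p)
  next
    case False
    \<comment> \<open>For a fixed point (a, b), \<open>nfun\<close> is an affine function of tau;
      this is its coefficient form. It is a nonzero polynomial exactly because the gradient at (a,
      b) is nonzero.\<close>
    then have "[:[:?f2 * a - ?f1 * b, - ?f2:], [:?f1:]:] \<noteq> 0" by auto
    from generically_nonzero[OF this] show ?thesis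
      by (rule generically_mono) (auto simp: p nfun_def algebra_simps)
  qed
qed

lemma card_square_roots:
  assumes "finite A" "0 \<notin> A"
  shows "card {d::complex. d\<^sup>2 \<in> A} = 2 * card A"
proof -
  have fib: "{d. d\<^sup>2 = e} = {csqrt e, - csqrt e}" for e :: complex
    using power2_eq_iff[of _ "csqrt e"] by auto
  have "{d::complex. d\<^sup>2 \<in> A} = (\<Union>e\<in>A. {d. d\<^sup>2 = e})" by auto
  also have "card \<dots> = (\<Sum>e\<in>A. card {d::complex. d\<^sup>2 = e})"
  proof (rule card_UN_disjoint)
    show "\<forall>e\<in>A. \<forall>e'\<in>A. e \<noteq> e' \<longrightarrow> {d. d\<^sup>2 = e} \<inter> {d. d\<^sup>2 = e'} = {}" by auto
  qed (simp_all add: assms(1) fib)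
  also have "\<dots> = (\<Sum>e\<in>A. 2)"
    by (rule sum.cong) (use assms(2) in \<open>auto simp: fib card_insert_if\<close>)
  finally show ?thesis by simp
qed

theorem mainTheorem11:
  fixes f :: poly2 and g :: poly3
  assumes irr: "irreducible f"
    and notline: "\<not> is_line (curve f)"
    and nondiv: "\<not> f dvd ((pd1 f)^2 + (pd2 f)^2)"
    and geq: "generic_offset_eq f g"
  shows "\<exists>U. zopen2 U \<and> U \<noteq> {} \<and>
    (\<forall>\<tau>1 \<tau>2. (\<tau>1,\<tau>2) \<in> U \<longrightarrow>
      (let \<mu> = degree g div 2;
           \<Gamma> = {(a,b). ev2 f a b = 0 \<and> (ev2 (pd1 f) a b)^2 + (ev2 (pd2 f) a b)^2 \<noteq> 0
                       \<and> nfun f a b \<tau>1 \<tau>2 = 0}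
       in
        (\<forall>a b. ev2 f a b = 0 \<and> (ev2 (pd1 f) a b, ev2 (pd2 f) a b) \<noteq> (0,0)
             \<and> ((a,b) = (0,0) \<or> (ev2 (pd1 f) a b)^2 + (ev2 (pd2 f) a b)^2 = 0)
             \<longrightarrow> nfun f a b \<tau>1 \<tau>2 \<noteq> 0)
      \<and> finite \<Gamma> \<and> card \<Gamma> = \<mu>
      \<and> inj_on (\<lambda>(a,b). (a - \<tau>1)^2 + (b - \<tau>2)^2) \<Gamma>
      \<and> (\<forall>(a,b)\<in>\<Gamma>. (a - \<tau>1)^2 + (b - \<tau>2)^2 \<noteq> 0)
      \<and> (\<forall>(a,b)\<in>\<Gamma>. \<forall>d. d^2 = (a - \<tau>1)^2 + (b - \<tau>2)^2 \<longrightarrow>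
             (\<tau>1,\<tau>2) \<in> offset f d \<and> offset f d = offset f (-d)
             \<and> (\<exists>u0. ((a,b),(\<tau>1,\<tau>2),d,u0) \<in> Omega f \<or> ((a,b),(\<tau>1,\<tau>2),-d,u0) \<in> Omega f))))"
proof -
  have deg: "degree f > 0" using irr notline by (rule degree_pos_if_not_line)
  have sf: "squarefree g" using geq by (simp add: generic_offset_eq_def)
  then have "lead_coeff g \<noteq> 0" "f \<noteq> 0" using deg by auto
  \<comment> \<open>The isotropic points are finitely many because f does not divide f1^2 + f2^2.
    Adding the origin covers all points that (1) speaks of.\<close>
  define E where "E = insert (0, 0) {(a, b). ev2 f a b = 0 \<and> ev2 ((pd1 f)\<^sup>2 + (pd2 f)\<^sup>2) a b = 0}"
  have "finite E" using finite_common_zeros[OF irr deg nondiv] by (simp add: E_def)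
  \<comment> \<open>Keeping tau off the curve makes the squared distances nonzero; the leading
    coefficient keeps the degree of g(tau, d) equal to deg_d g.\<close>
  define good where "good \<tau>1 \<tau>2 \<longleftrightarrow> ev2 f \<tau>1 \<tau>2 \<noteq> 0 \<and> ev2 (lead_coeff g) \<tau>1 \<tau>2 \<noteq> 0 \<and>
    (\<forall>d. ev3 g \<tau>1 \<tau>2 d = 0 \<longrightarrow> ev3 (pderiv g) \<tau>1 \<tau>2 d \<noteq> 0) \<and>
    (\<forall>d. ev3 g \<tau>1 \<tau>2 d = 0 \<longrightarrow> (\<tau>1, \<tau>2, d) \<in> offset_pts f) \<and>
    (\<forall>(a, b)\<in>E. (ev2 (pd1 f) a b, ev2 (pd2 f) a b) \<noteq> (0, 0) \<longrightarrow> nfun f a b \<tau>1 \<tau>2 \<noteq> 0)" for \<tau>1 \<tau>2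
  have "generically good"
    unfolding good_def
    by (intro generically_conj generically_nonzero generic_roots_simple generic_roots_are_offset_pts
        generic_no_special_feet sf geq) fact+
  then obtain r where r: "r \<noteq> 0" "\<And>\<tau>1 \<tau>2. ev2 r \<tau>1 \<tau>2 \<noteq> 0 \<Longrightarrow> good \<tau>1 \<tau>2"
    unfolding generically_def by blast
  define U where "U = {(\<tau>1, \<tau>2). ev2 r \<tau>1 \<tau>2 \<noteq> 0}"
  have "- U = {(a, b). \<forall>h\<in>{r}. ev2 h a b = 0}" by (auto simp: U_def)
  then have "zopen2 U" unfolding zopen2_def zclosed2_def by blast
  moreover have "U \<noteq> {}" using ev2_nonzero_exists[OF r(1)] by (auto simp: U_def)
  moreover {
    fix \<tau>1 \<tau>2 assume "(\<tau>1, \<tau>2) \<in> U"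
    then have "good \<tau>1 \<tau>2" using r(2) by (simp add: U_def)
    then have not_curve: "ev2 f \<tau>1 \<tau>2 \<noteq> 0" and lc: "ev2 (lead_coeff g) \<tau>1 \<tau>2 \<noteq> 0"
      and simple: "\<And>d. ev3 g \<tau>1 \<tau>2 d = 0 \<Longrightarrow> ev3 (pderiv g) \<tau>1 \<tau>2 d \<noteq> 0"
      and roots: "\<And>d. ev3 g \<tau>1 \<tau>2 d = 0 \<Longrightarrow> (\<tau>1, \<tau>2, d) \<in> offset_pts f"
      and special: "\<And>a b. (a, b) \<in> E \<Longrightarrow> (ev2 (pd1 f) a b, ev2 (pd2 f) a b) \<noteq> (0, 0) \<Longrightarrow>
        nfun f a b \<tau>1 \<tau>2 \<noteq> 0"
      unfolding good_def by blast+
    let ?D = "\<lambda>(a, b). (a - \<tau>1)\<^sup>2 + (b - \<tau>2)\<^sup>2"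
    let ?\<Gamma> = "feet f \<tau>1 \<tau>2"
    have inj: "inj_on ?D ?\<Gamma>" by (rule inj_on_sqdist_feet[OF irr deg geq simple])
    have nz: "?D p \<noteq> 0" if "p \<in> ?\<Gamma>" for p
    proof
      assume 0: "?D p = 0"
      obtain a b where p: "p = (a, b)" by fastforce
      from that have "(a, b) \<in> ?\<Gamma>" by (simp add: p)
      from feet_param[OF this] obtain t where t: "\<tau>1 = a + t * ev2 (pd1 f) a b" "\<tau>2 = b + t * ev2 (pd2 f) a b"
        "(\<tau>1 - a)\<^sup>2 + (\<tau>2 - b)\<^sup>2 = t\<^sup>2 * gsq f a b"
        by blast
      have ab: "ev2 f a b = 0" "gsq f a b \<noteq> 0" using that p by (auto simp: feet_def)
      \<comment> \<open>A zero squared distance from a non-isotropic foot forces tau to be the foot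
        itself, hence a point of the curve.\<close>
      have "t = 0" using t(3) 0 ab(2) by (simp add: p power2_commute)
      with t ab(1) not_curve show False by simp
    qed
    have "{d. ev3 g \<tau>1 \<tau>2 d = 0} = {d. d\<^sup>2 \<in> ?D ` ?\<Gamma>}"
    proof -
      have "(\<tau>1, \<tau>2, d) \<in> offset_pts f \<longleftrightarrow> d\<^sup>2 \<in> ?D ` ?\<Gamma>" for d
      proof -
        have "bfun a b \<tau>1 \<tau>2 d = 0 \<longleftrightarrow> d\<^sup>2 = (a - \<tau>1)\<^sup>2 + (b - \<tau>2)\<^sup>2" for a b
          unfolding bfun_def power2_commute[of \<tau>1] power2_commute[of \<tau>2] by auto
        then have "(\<tau>1, \<tau>2, d) \<in> offset_pts f \<longleftrightarrow>
            (\<exists>(a, b)\<in>?\<Gamma>. d\<^sup>2 = (a - \<tau>1)\<^sup>2 + (b - \<tau>2)\<^sup>2)"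
          by (simp add: offset_pts_def)
        then show ?thesis by auto
      qed
      then show ?thesis using roots generic_offset_eq_vanish(1)[OF geq] by blast
    qed
    with card_simple_roots[OF lc simple]
    have card: "card {d. d\<^sup>2 \<in> ?D ` ?\<Gamma>} = degree g" and "finite {d. d\<^sup>2 \<in> ?D ` ?\<Gamma>}" by simp_all
    \<comment> \<open>Every value of D is the square of a root of g(tau, d), so there are finitely
      many values, and injectivity of D carries finiteness over to the feet.\<close>
    moreover have "?D ` ?\<Gamma> \<subseteq> (\<lambda>d. d\<^sup>2) ` {d. d\<^sup>2 \<in> ?D ` ?\<Gamma>}"
    proof
      fix e assume "e \<in> ?D ` ?\<Gamma>"
      then show "e \<in> (\<lambda>d. d\<^sup>2) ` {d. d\<^sup>2 \<in> ?D ` ?\<Gamma>}" by (intro image_eqI[of _ _ "csqrt e"]) simp_all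
    qed
    ultimately have finD: "finite (?D ` ?\<Gamma>)" using finite_surj by blast
    then have fin: "finite ?\<Gamma>" using inj finite_imageD by blast
    \<comment> \<open>Each nonzero value of D contributes two roots, and distinct feet contribute
      distinct values.\<close>
    have "degree g = 2 * card ?\<Gamma>"
      using card_square_roots[OF finD] nz card card_image[OF inj] by fastforce
    then have cardG: "card ?\<Gamma> = degree g div 2" by simp
    have offs: "(\<tau>1, \<tau>2) \<in> offset f d \<and> offset f d = offset f (- d) \<and>
        (\<exists>u0. ((a, b), (\<tau>1, \<tau>2), d, u0) \<in> Omega f \<or> ((a, b), (\<tau>1, \<tau>2), - d, u0) \<in> Omega f)"
      if ab: "(a, b) \<in> ?\<Gamma>" and d: "d\<^sup>2 = (a - \<tau>1)\<^sup>2 + (b - \<tau>2)\<^sup>2" for a b d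
    proof (intro conjI)
      have pt: "ev2 f a b = 0" "bfun a b \<tau>1 \<tau>2 d = 0" "nfun f a b \<tau>1 \<tau>2 = 0"
        "wfun f a b (1 / gsq f a b) = 0"
        using ab d by (simp_all add: feet_def bfun_def wfun_def power2_commute)
      then have "((a, b), (\<tau>1, \<tau>2), 1 / gsq f a b) \<in> Omega_at f d" by (simp add: Omega_at_def)
      then have "(\<tau>1, \<tau>2) \<in> (\<lambda>(y, x, u). x) ` Omega_at f d" by (rule rev_image_eqI) simp
      then show "(\<tau>1, \<tau>2) \<in> offset f d" unfolding offset_def zclosure2_def by blast
      show "offset f d = offset f (- d)" by (simp add: offset_def Omega_at_def bfun_def)
      show "\<exists>u0. ((a, b), (\<tau>1, \<tau>2), d, u0) \<in> Omega f \<or> ((a, b), (\<tau>1, \<tau>2), - d, u0) \<in> Omega f"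
        using pt unfolding Omega_def by blast
    qed
    have reg: "nfun f a b \<tau>1 \<tau>2 \<noteq> 0"
      if "ev2 f a b = 0" "(ev2 (pd1 f) a b, ev2 (pd2 f) a b) \<noteq> (0, 0)"
        "(a, b) = (0, 0) \<or> gsq f a b = 0" for a b
      using special[of a b] that by (auto simp: E_def)
    note reg fin cardG inj nz offs
  }
  note facts = this
  ultimately show ?thesis
    unfolding Let_def feet_def[symmetric]
  proof (intro exI[of _ U] conjI allI impI)
    fix \<tau>1 \<tau>2 assume "(\<tau>1, \<tau>2) \<in> U"
    note F = facts[OF this]
    show "nfun f a b \<tau>1 \<tau>2 \<noteq> 0"
      if "ev2 f a b = 0 \<and> (ev2 (pd1 f) a b, ev2 (pd2 f) a b) \<noteq> (0, 0) \<and>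
        ((a, b) = (0, 0) \<or> gsq f a b = 0)" for a b
      using that by (elim conjE) (rule F(1))
    show "finite (feet f \<tau>1 \<tau>2)" "card (feet f \<tau>1 \<tau>2) = degree g div 2"
      "inj_on (\<lambda>(a, b). (a - \<tau>1)\<^sup>2 + (b - \<tau>2)\<^sup>2) (feet f \<tau>1 \<tau>2)"
      by (fact F(2) F(3) F(4))+
    show "\<forall>(a, b)\<in>feet f \<tau>1 \<tau>2. (a - \<tau>1)\<^sup>2 + (b - \<tau>2)\<^sup>2 \<noteq> 0"
      using F(5) by fastforce
    show "\<forall>(a, b)\<in>feet f \<tau>1 \<tau>2. \<forall>d. d\<^sup>2 = (a - \<tau>1)\<^sup>2 + (b - \<tau>2)\<^sup>2 \<longrightarrow>
        (\<tau>1, \<tau>2) \<in> offset f d \<and> offset f d = offset f (- d) \<and>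
        (\<exists>u0. ((a, b), (\<tau>1, \<tau>2), d, u0) \<in> Omega f \<or> ((a, b), (\<tau>1, \<tau>2), - d, u0) \<in> Omega f)"
      using F(6) by blast
  qed
qed

end
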